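(* Let $S$ be a commutative associative finitely generated unital algebra over $\mathbb C$ and let $V$ be an irreducible $\dot{\mathfrak g}\otimes S$-module with finite dimensional weight spaces with respect to $\dot{\mathfrak h}$. Then there exists a co-finite ideal $I$ of $S$ such that $V$ is a module for the finite dimensional Lie algebra $\dot{\mathfrak g}\otimes S/I$ (i.e. $\dot{\mathfrak g}\otimes I$ acts trivially on $V$).
   Context: $\dot{\mathfrak g}$ is a finite dimensional simple Lie algebra over $\mathbb C$ with Cartan subalgebra $\dot{\mathfrak h}$, identified with $\dot{\mathfrak h}\otimes1\subset\dot{\mathfrak g}\otimes S$. The bracket on $\dot{\mathfrak g}\otimes S$ is $[x\otimes s,y\otimes s']=[x,y]\otimes ss'$. "Finite dimensional weight spaces" means that $V=\bigoplus_{\lambda\in\dot{\mathfrak h}^*}V_\lambda$ with $V_\lambda=\{v:hv=\lambda(h)v\ \forall h\in\dot{\mathfrak h}\}$ and each $V_\lambda$ is finite dimensional. An ideal $I$ is co-finite if $\dim_{\mathbb C}S/I<\infty$. *)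

theory Defs
  imports Complex_Main "HOL-Library.Poly_Mapping"
begin

section \<open>Complex vector spaces\<close>

class complex_vector_space = ab_group_add +
  fixes cscale :: "complex \<Rightarrow> 'a \<Rightarrow> 'a"  (infixr \<open>*\<^sub>C\<close> 75)
  assumes cscale_add_right: "c *\<^sub>C (x + y) = c *\<^sub>C x + c *\<^sub>C y"
    and cscale_add_left: "(c + d) *\<^sub>C x = c *\<^sub>C x + d *\<^sub>C x"
    and cscale_cscale: "c *\<^sub>C (d *\<^sub>C x) = (c * d) *\<^sub>C x"
    and cscale_one: "1 *\<^sub>C x = x"

interpretation cvec: vector_space "cscale :: complex \<Rightarrow> 'a \<Rightarrow> 'a::complex_vector_space"
  by unfold_locales (simp_all add: cscale_add_right cscale_add_left cscale_cscale cscale_one)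

instantiation complex :: complex_vector_space
begin

definition cscale_complex :: "complex \<Rightarrow> complex \<Rightarrow> complex" where
  "cscale_complex c z = c * z"

instance
  by standard (simp_all add: cscale_complex_def algebra_simps)

end

abbreviation clinear :: "('a::complex_vector_space \<Rightarrow> 'b::complex_vector_space) \<Rightarrow> bool" where
  "clinear \<equiv> Vector_Spaces.linear cscale cscale"

lemma clinearI:
  assumes "\<And>x y. f (x + y) = f x + f y" and "\<And>c x. f (c *\<^sub>C x) = c *\<^sub>C f x"
  shows "clinear f"
  by unfold_locales (use assms in auto)

lemma clinear_add: "clinear f \<Longrightarrow> f (x + y) = f x + f y"
  and clinear_scale: "clinear f \<Longrightarrow> f (c *\<^sub>C x) = c *\<^sub>C f x"
  by (simp_all add: Vector_Spaces.linear_def module_hom_def module_hom_axioms_def)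

definition cbilinear ::
  "('a::complex_vector_space \<Rightarrow> 'b::complex_vector_space \<Rightarrow> 'c::complex_vector_space) \<Rightarrow> bool" where
  "cbilinear f \<longleftrightarrow> (\<forall>x. clinear (f x)) \<and> (\<forall>y. clinear (\<lambda>x. f x y))"

definition fin_dim :: "'a::complex_vector_space set \<Rightarrow> bool" where
  "fin_dim W \<longleftrightarrow> (\<exists>B. finite B \<and> cvec.span B = W)"

text \<open>The whole space is the internal direct sum of the subspaces \<open>W a\<close>, \<open>a \<in> A\<close>.\<close>

definition is_direct_sum :: "'i set \<Rightarrow> ('i \<Rightarrow> 'v::complex_vector_space set) \<Rightarrow> bool" where
  "is_direct_sum A W \<longleftrightarrow>
     (\<forall>a\<in>A. cvec.subspace (W a)) \<and>
     (\<forall>v. \<exists>!f. (\<forall>a\<in>A. f a \<in> W a) \<and> (\<forall>a. a \<notin> A \<longrightarrow> f a = 0) \<and>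
                finite {a. f a \<noteq> 0} \<and> v = (\<Sum>a | f a \<noteq> 0. f a))"


section \<open>Commutative algebras\<close>

text \<open>Commutative associative unital algebras. The class \<^class>\<open>comm_ring_1\<close> is avoided because it
  excludes the zero algebra.\<close>

class complex_comm_algebra = complex_vector_space + comm_ring + comm_monoid_mult +
  assumes cscale_mult_left: "(c *\<^sub>C x) * y = c *\<^sub>C (x * y)"

lemma cscale_mult_right: "x * (c *\<^sub>C y) = c *\<^sub>C (x * (y::'s::complex_comm_algebra))"
  by (metis cscale_mult_left mult.commute)

definition is_subalgebra :: "'s::complex_comm_algebra set \<Rightarrow> bool" where
  "is_subalgebra A \<longleftrightarrow> cvec.subspace A \<and> 1 \<in> A \<and> (\<forall>a\<in>A. \<forall>b\<in>A. a * b \<in> A)"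

definition fin_gen_algebra :: "'s::complex_comm_algebra itself \<Rightarrow> bool" where
  "fin_gen_algebra _ \<longleftrightarrow> (\<exists>F::'s set. finite F \<and> is_subalgebra hull F = UNIV)"

definition is_alg_ideal :: "'s::complex_comm_algebra set \<Rightarrow> bool" where
  "is_alg_ideal I \<longleftrightarrow> cvec.subspace I \<and> (\<forall>s. \<forall>i\<in>I. s * i \<in> I)"

text \<open>\<open>dim S/I < \<infinity>\<close>: the classes modulo \<open>I\<close> of finitely many elements span \<open>S/I\<close>.\<close>

definition cofinite_in :: "'s::complex_vector_space set \<Rightarrow> bool" where
  "cofinite_in I \<longleftrightarrow> (\<exists>B. finite B \<and> (\<forall>s. \<exists>b\<in>cvec.span B. s - b \<in> I))"


section \<open>Lie algebras\<close>

class complex_lie_algebra = complex_vector_space +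
  fixes bracket :: "'a \<Rightarrow> 'a \<Rightarrow> 'a"
  assumes bracket_add_left: "bracket (x + y) z = bracket x z + bracket y z"
    and bracket_add_right: "bracket x (y + z) = bracket x y + bracket x z"
    and bracket_scale_left: "bracket (c *\<^sub>C x) y = c *\<^sub>C bracket x y"
    and bracket_scale_right: "bracket x (c *\<^sub>C y) = c *\<^sub>C bracket x y"
    and bracket_self: "bracket x x = 0"
    and jacobi: "bracket x (bracket y z) + bracket y (bracket z x) + bracket z (bracket x y) = 0"

lemma bracket_antisym: "bracket x y = - bracket y (x::'g::complex_lie_algebra)"
proof -
  have "0 = bracket (x + y) (x + y)" by (simp only: bracket_self)
  also have "\<dots> = bracket x y + bracket y x"
    by (simp only: bracket_add_left bracket_add_right) (simp add: bracket_self)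
  finally show ?thesis by (metis eq_neg_iff_add_eq_0)
qed

definition is_lie_ideal :: "'g::complex_lie_algebra set \<Rightarrow> bool" where
  "is_lie_ideal J \<longleftrightarrow> cvec.subspace J \<and> (\<forall>x. \<forall>y\<in>J. bracket x y \<in> J)"

definition simple_lie_algebra :: "'g::complex_lie_algebra itself \<Rightarrow> bool" where
  "simple_lie_algebra _ \<longleftrightarrow>
     (\<exists>x y::'g. bracket x y \<noteq> 0) \<and> (\<forall>J::'g set. is_lie_ideal J \<longrightarrow> J = {0} \<or> J = UNIV)"

definition is_lie_subalgebra :: "'g::complex_lie_algebra set \<Rightarrow> bool" where
  "is_lie_subalgebra H \<longleftrightarrow> cvec.subspace H \<and> (\<forall>x\<in>H. \<forall>y\<in>H. bracket x y \<in> H)"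

fun lower_central :: "'g::complex_lie_algebra set \<Rightarrow> nat \<Rightarrow> 'g set" where
  "lower_central H 0 = H"
| "lower_central H (Suc n) = cvec.span {bracket x y | x y. x \<in> H \<and> y \<in> lower_central H n}"

definition is_cartan_subalgebra :: "'g::complex_lie_algebra set \<Rightarrow> bool" where
  "is_cartan_subalgebra H \<longleftrightarrow> is_lie_subalgebra H \<and>
     (\<exists>n. lower_central H n = {0}) \<and> {x. \<forall>h\<in>H. bracket x h \<in> H} = H"

text \<open>The dual space of a subspace \<open>H\<close>; a functional on \<open>H\<close> is represented by its extension by
  zero outside of \<open>H\<close>, so that functionals correspond one-to-one to elements of this set.\<close>

definition dual_space :: "'g::complex_vector_space set \<Rightarrow> ('g \<Rightarrow> complex) set" where
  "dual_space H = {\<mu>. (\<forall>x\<in>H. \<forall>y\<in>H. \<mu> (x + y) = \<mu> x + \<mu> y) \<and>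
                      (\<forall>c. \<forall>x\<in>H. \<mu> (c *\<^sub>C x) = c * \<mu> x) \<and> (\<forall>x. x \<notin> H \<longrightarrow> \<mu> x = 0)}"


section \<open>Modules over Lie algebras\<close>

definition lie_module :: "('l::complex_lie_algebra \<Rightarrow> 'v::complex_vector_space \<Rightarrow> 'v) \<Rightarrow> bool" where
  "lie_module act \<longleftrightarrow> cbilinear act \<and>
     (\<forall>a b v. act (bracket a b) v = act a (act b v) - act b (act a v))"

definition is_submodule ::
  "('l::complex_lie_algebra \<Rightarrow> 'v::complex_vector_space \<Rightarrow> 'v) \<Rightarrow> 'v set \<Rightarrow> bool" where
  "is_submodule act W \<longleftrightarrow> cvec.subspace W \<and> (\<forall>a. \<forall>w\<in>W. act a w \<in> W)"

definition irreducible_module ::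
  "('l::complex_lie_algebra \<Rightarrow> 'v::complex_vector_space \<Rightarrow> 'v) \<Rightarrow> bool" where
  "irreducible_module act \<longleftrightarrow> lie_module act \<and> (\<exists>v::'v. v \<noteq> 0) \<and>
     (\<forall>W. is_submodule act W \<longrightarrow> W = {0} \<or> W = UNIV)"


section \<open>Tensor products\<close>

text \<open>The tensor product over the complex numbers is the quotient of the free vector space on
  \<open>'a \<times> 'b\<close> by the subspace spanned by the bilinearity relations.\<close>

instantiation poly_mapping :: (type, complex_vector_space) complex_vector_space
begin

lift_definition cscale_poly_mapping :: "complex \<Rightarrow> ('a \<Rightarrow>\<^sub>0 'b) \<Rightarrow> 'a \<Rightarrow>\<^sub>0 'b"
  is "\<lambda>c f k. c *\<^sub>C f k"
proof -
  fix c :: complex and f :: "'a \<Rightarrow> 'b"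
  assume "finite {x. f x \<noteq> 0}"
  then show "finite {x. c *\<^sub>C f x \<noteq> 0}"
    by (rule rev_finite_subset) auto
qed

instance
  by standard (transfer; simp add: fun_eq_iff cscale_add_right cscale_add_left cscale_cscale cscale_one)+

end

lemma lookup_cscale: "Poly_Mapping.lookup (c *\<^sub>C f) k = c *\<^sub>C Poly_Mapping.lookup f k"
  by transfer simp

definition tensor_relations ::
  "('a::complex_vector_space \<times> 'b::complex_vector_space \<Rightarrow>\<^sub>0 complex) set" where
  "tensor_relations = cvec.span
     ({Poly_Mapping.single (x + y, s) 1 - Poly_Mapping.single (x, s) 1 - Poly_Mapping.single (y, s) 1 | x y s. True} \<union>
      {Poly_Mapping.single (x, s + t) 1 - Poly_Mapping.single (x, s) 1 - Poly_Mapping.single (x, t) 1 | x s t. True} \<union>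
      {Poly_Mapping.single (c *\<^sub>C x, s) 1 - c *\<^sub>C Poly_Mapping.single (x, s) 1 | c x s. True} \<union>
      {Poly_Mapping.single (x, c *\<^sub>C s) 1 - c *\<^sub>C Poly_Mapping.single (x, s) 1 | c x s. True})"

lemma subspace_tensor_relations: "cvec.subspace tensor_relations"
  unfolding tensor_relations_def by (rule cvec.subspace_span)

quotient_type (overloaded) ('a, 'b) tensor =
    "('a::complex_vector_space \<times> 'b::complex_vector_space) \<Rightarrow>\<^sub>0 complex" /
    "\<lambda>f g. f - g \<in> tensor_relations"
proof (rule equivpI)
  show "reflp (\<lambda>f g. f - g \<in> (tensor_relations :: ('a \<times> 'b \<Rightarrow>\<^sub>0 complex) set))"
    by (simp add: reflp_def cvec.subspace_0 subspace_tensor_relations)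
  show "symp (\<lambda>f g. f - g \<in> (tensor_relations :: ('a \<times> 'b \<Rightarrow>\<^sub>0 complex) set))"
    by (metis (no_types, lifting) cvec.subspace_neg minus_diff_eq subspace_tensor_relations symp_def)
  show "transp (\<lambda>f g. f - g \<in> (tensor_relations :: ('a \<times> 'b \<Rightarrow>\<^sub>0 complex) set))"
  proof (rule transpI)
    fix f g h :: "'a \<times> 'b \<Rightarrow>\<^sub>0 complex"
    assume "f - g \<in> tensor_relations" "g - h \<in> tensor_relations"
    from cvec.subspace_add[OF subspace_tensor_relations this]
    show "f - h \<in> tensor_relations" by simp
  qed
qed

instantiation tensor :: (complex_vector_space, complex_vector_space) complex_vector_space
begin

lift_definition zero_tensor :: "('a, 'b) tensor" is 0 .

lift_definition plus_tensor :: "('a, 'b) tensor \<Rightarrow> ('a, 'b) tensor \<Rightarrow> ('a, 'b) tensor" is "(+)"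
  by (metis (no_types, lifting) add_diff_add cvec.subspace_add subspace_tensor_relations)

lift_definition uminus_tensor :: "('a, 'b) tensor \<Rightarrow> ('a, 'b) tensor" is uminus
  by (metis (no_types, lifting) cvec.subspace_neg minus_diff_minus subspace_tensor_relations)

lift_definition minus_tensor :: "('a, 'b) tensor \<Rightarrow> ('a, 'b) tensor \<Rightarrow> ('a, 'b) tensor" is "(-)"
proof -
  fix f f' g g' :: "'a \<times> 'b \<Rightarrow>\<^sub>0 complex"
  assume "f - f' \<in> tensor_relations" "g - g' \<in> tensor_relations"
  from cvec.subspace_diff[OF subspace_tensor_relations this]
  show "f - g - (f' - g') \<in> tensor_relations" by (simp add: algebra_simps)
qed

lift_definition cscale_tensor :: "complex \<Rightarrow> ('a, 'b) tensor \<Rightarrow> ('a, 'b) tensor" is "(*\<^sub>C)"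
  by (metis (no_types, lifting) cvec.scale_right_diff_distrib cvec.subspace_scale subspace_tensor_relations)

instance
proof
  fix x y z :: "('a, 'b) tensor" and c d :: complex
  note [simp] = cvec.subspace_0[OF subspace_tensor_relations]
  show "x + y + z = x + (y + z)" by transfer (simp add: algebra_simps)
  show "x + y = y + x" by transfer (simp add: algebra_simps)
  show "0 + x = x" by transfer simp
  show "- x + x = 0" by transfer simp
  show "x - y = x + - y" by transfer simp
  show "c *\<^sub>C (x + y) = c *\<^sub>C x + c *\<^sub>C y" by transfer (simp add: cscale_add_right)
  show "(c + d) *\<^sub>C x = c *\<^sub>C x + d *\<^sub>C x" by transfer (simp add: cscale_add_left)
  show "c *\<^sub>C d *\<^sub>C x = (c * d) *\<^sub>C x" by transfer (simp add: cscale_cscale)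
  show "1 *\<^sub>C x = x" by transfer (simp add: cscale_one)
qed

end

lift_definition pure_tensor ::
    "'a::complex_vector_space \<Rightarrow> 'b::complex_vector_space \<Rightarrow> ('a, 'b) tensor"  (infixl \<open>\<otimes>\<close> 78)
  is "\<lambda>x s. Poly_Mapping.single (x, s) 1" .

lemma pure_tensor_add_left: "(x + y) \<otimes> s = x \<otimes> s + y \<otimes> s"
  by transfer (unfold tensor_relations_def diff_diff_eq[symmetric], rule cvec.span_base, blast)

lemma pure_tensor_add_right: "x \<otimes> (s + t) = x \<otimes> s + x \<otimes> t"
  by transfer (unfold tensor_relations_def diff_diff_eq[symmetric], rule cvec.span_base, blast)

lemma pure_tensor_scale_left: "(c *\<^sub>C x) \<otimes> s = c *\<^sub>C (x \<otimes> s)"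
  by transfer (unfold tensor_relations_def, rule cvec.span_base, blast)

lemma pure_tensor_scale_right: "x \<otimes> (c *\<^sub>C s) = c *\<^sub>C (x \<otimes> s)"
  by transfer (unfold tensor_relations_def, rule cvec.span_base, blast)

lemma poly_mapping_sum_single:
  "f = (\<Sum>k\<in>Poly_Mapping.keys f. Poly_Mapping.lookup f k *\<^sub>C Poly_Mapping.single k (1::complex))"
  by (rule poly_mapping_eqI)
    (auto simp: lookup_sum lookup_cscale lookup_single when_def cscale_complex_def in_keys_iff
      if_distrib[of "\<lambda>x. _ * x"] cong: if_cong)

lemma tensor_induct [case_names zero add pure]:
  assumes zero: "P 0" and add: "\<And>t u. P t \<Longrightarrow> P u \<Longrightarrow> P (t + u)" and pure: "\<And>x s. P (x \<otimes> s)"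
  shows "P t"
proof (induct t rule: tensor.abs_induct)
  case (1 f)
  have "P (abs_tensor (\<Sum>k\<in>A. Poly_Mapping.lookup f k *\<^sub>C Poly_Mapping.single k 1))" if "finite A" for A
    using that
  proof induct
    case empty
    then show ?case using zero by (simp add: zero_tensor.abs_eq)
  next
    case (insert k A)
    obtain x s where k: "k = (x, s)" by force
    have "abs_tensor (Poly_Mapping.lookup f k *\<^sub>C Poly_Mapping.single k 1) = (Poly_Mapping.lookup f k *\<^sub>C x) \<otimes> s"
      by (simp only: pure_tensor_scale_left) (simp only: pure_tensor.abs_eq cscale_tensor.abs_eq k)
    with insert pure[of "Poly_Mapping.lookup f k *\<^sub>C x" s] show ?case
      by (simp add: plus_tensor.abs_eq[symmetric] add)
  qed
  from this[OF finite_keys[of f]] show ?case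
    by (simp add: poly_mapping_sum_single[symmetric])
qed

definition free_lift :: "('k \<Rightarrow> 'c::complex_vector_space) \<Rightarrow> ('k \<Rightarrow>\<^sub>0 complex) \<Rightarrow> 'c" where
  "free_lift \<phi> f = (\<Sum>k\<in>Poly_Mapping.keys f. Poly_Mapping.lookup f k *\<^sub>C \<phi> k)"

lemma free_lift_superset:
  "finite A \<Longrightarrow> Poly_Mapping.keys f \<subseteq> A \<Longrightarrow> free_lift \<phi> f = (\<Sum>k\<in>A. Poly_Mapping.lookup f k *\<^sub>C \<phi> k)"
  unfolding free_lift_def by (rule sum.mono_neutral_left) (auto simp: in_keys_iff)

lemma clinear_free_lift: "clinear (free_lift \<phi>)"
proof (rule clinearI)
  fix f g :: "'a \<Rightarrow>\<^sub>0 complex" and c :: complex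
  have "Poly_Mapping.keys (f + g) \<subseteq> Poly_Mapping.keys f \<union> Poly_Mapping.keys g" by (rule keys_add)
  then show "free_lift \<phi> (f + g) = free_lift \<phi> f + free_lift \<phi> g"
    by (simp add: free_lift_superset[of "Poly_Mapping.keys f \<union> Poly_Mapping.keys g"] lookup_add cscale_add_left sum.distrib)
  have "Poly_Mapping.keys (c *\<^sub>C f) \<subseteq> Poly_Mapping.keys f"
    by (auto simp: in_keys_iff lookup_cscale)
  then show "free_lift \<phi> (c *\<^sub>C f) = c *\<^sub>C free_lift \<phi> f"
    by (simp add: free_lift_superset[of "Poly_Mapping.keys f"] lookup_cscale cvec.scale_sum_right
        cscale_cscale cscale_complex_def)
qed

lemma free_lift_single: "free_lift \<phi> (Poly_Mapping.single k 1) = \<phi> k"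
  by (simp add: free_lift_def cscale_one)

text \<open>The linear map induced by a bilinear map; meaningful for bilinear \<open>\<phi>\<close>, when it does not
  depend on the chosen representative.\<close>

definition tensor_lift ::
  "('a::complex_vector_space \<Rightarrow> 'b::complex_vector_space \<Rightarrow> 'c::complex_vector_space) \<Rightarrow>
   ('a, 'b) tensor \<Rightarrow> 'c" where
  "tensor_lift \<phi> t = free_lift (\<lambda>(x, s). \<phi> x s) (rep_tensor t)"

lemma tensor_lift_abs:
  assumes "cbilinear \<phi>"
  shows "tensor_lift \<phi> (abs_tensor f) = free_lift (\<lambda>(x, s). \<phi> x s) f"
proof -
  let ?L = "free_lift (\<lambda>(x, s). \<phi> x s)"
  interpret L: Vector_Spaces.linear cscale cscale ?L by (rule clinear_free_lift)
  have 1: "clinear (\<phi> x)" and 2: "clinear (\<lambda>x. \<phi> x y)" for x y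
    using assms by (auto simp: cbilinear_def)
  have "tensor_relations \<subseteq> {r. ?L r = 0}"
    unfolding tensor_relations_def
    by (rule cvec.span_minimal)
      (auto simp: L.diff L.scale free_lift_single clinear_add[OF 1] clinear_add[OF 2]
        clinear_scale[OF 1] clinear_scale[OF 2] L.subspace_kernel)
  moreover have "rep_tensor (abs_tensor f) - f \<in> tensor_relations"
    by (rule rep_abs_rsp_left[OF Quotient3_tensor])
      (simp add: cvec.subspace_0 subspace_tensor_relations)
  ultimately have "?L (rep_tensor (abs_tensor f) - f) = 0" by blast
  then show ?thesis by (simp add: tensor_lift_def L.diff)
qed

lemma tensor_lift_pure: "cbilinear \<phi> \<Longrightarrow> tensor_lift \<phi> (x \<otimes> s) = \<phi> x s"
  by (simp add: pure_tensor.abs_eq tensor_lift_abs free_lift_single)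

lemma clinear_tensor_lift:
  assumes "cbilinear \<phi>" shows "clinear (tensor_lift \<phi>)"
proof (rule clinearI)
  interpret L: Vector_Spaces.linear cscale cscale "free_lift (\<lambda>(x, s). \<phi> x s)"
    by (rule clinear_free_lift)
  show "tensor_lift \<phi> (t + u) = tensor_lift \<phi> t + tensor_lift \<phi> u" for t u
    by (induct t, induct u) (simp add: plus_tensor.abs_eq tensor_lift_abs[OF assms] L.add)
  show "tensor_lift \<phi> (c *\<^sub>C t) = c *\<^sub>C tensor_lift \<phi> t" for c t
    by (induct t) (simp add: cscale_tensor.abs_eq tensor_lift_abs[OF assms] L.scale)
qed


section \<open>The Lie algebra \<open>\<gg> \<otimes> S\<close>\<close>

instantiation tensor :: (complex_lie_algebra, complex_comm_algebra) complex_lie_algebra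
begin

text \<open>The bilinear extension of \<open>[x \<otimes> s, y \<otimes> s'] = [x, y] \<otimes> s s'\<close>; see \<open>bracket_pure\<close> below.\<close>

definition bracket_tensor :: "('a, 'b) tensor \<Rightarrow> ('a, 'b) tensor \<Rightarrow> ('a, 'b) tensor" where
  "bracket_tensor t u = tensor_lift (\<lambda>x s. tensor_lift (\<lambda>y s'. bracket x y \<otimes> (s * s')) u) t"

lemma cbilinear_bracket_inner:
  "cbilinear (\<lambda>y s'. bracket x (y::'a) \<otimes> (s * (s'::'b)))"
  unfolding cbilinear_def
  by (intro conjI allI clinearI)
    (simp_all add: bracket_add_right bracket_scale_right pure_tensor_add_left pure_tensor_add_right
      pure_tensor_scale_left pure_tensor_scale_right distrib_left cscale_mult_right)

lemma cbilinear_bracket_outer: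
  "cbilinear (\<lambda>x s. tensor_lift (\<lambda>y s'. bracket x (y::'a) \<otimes> (s * (s'::'b))) u)"
proof -
  define L where "L x s = tensor_lift (\<lambda>y s'. bracket x (y::'a) \<otimes> (s * (s'::'b)))" for x s
  have lin: "clinear (L x s)" for x s
    unfolding L_def by (rule clinear_tensor_lift[OF cbilinear_bracket_inner])
  have L_pure: "L x s (y \<otimes> s') = bracket x y \<otimes> (s * s')" for x s y s'
    unfolding L_def by (rule tensor_lift_pure[OF cbilinear_bracket_inner])
  have L_zero: "L x s 0 = 0" for x s
    using clinear_scale[OF lin[of x s], of 0 0] by simp
  note L = clinear_add[OF lin] L_pure L_zero
  have "L x (s + t) u = L x s u + L x t u" for x s t
    by (induct u rule: tensor_induct)
      (simp_all add: L distrib_right pure_tensor_add_right)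
  moreover have "L x (c *\<^sub>C s) u = c *\<^sub>C L x s u" for x c s
    by (induct u rule: tensor_induct)
      (simp_all add: L cscale_mult_left pure_tensor_scale_right cscale_add_right)
  moreover have "L (x + y) s u = L x s u + L y s u" for x y s
    by (induct u rule: tensor_induct)
      (simp_all add: L bracket_add_left pure_tensor_add_left)
  moreover have "L (c *\<^sub>C x) s u = c *\<^sub>C L x s u" for x c s
    by (induct u rule: tensor_induct)
      (simp_all add: L bracket_scale_left pure_tensor_scale_left cscale_add_right)
  ultimately show ?thesis
    unfolding cbilinear_def L_def[symmetric] by (intro conjI allI clinearI) auto
qed

lemma bracket_pure:
  "bracket (x \<otimes> s) (y \<otimes> s') = bracket (x::'a) y \<otimes> (s * (s'::'b))"
  unfolding bracket_tensor_def tensor_lift_pure[OF cbilinear_bracket_outer]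
  by (rule tensor_lift_pure[OF cbilinear_bracket_inner])

lemma bracket_tensor_add_left: "bracket (t + u) v = bracket t v + bracket u (v :: ('a, 'b) tensor)"
  and bracket_tensor_scale_left: "bracket (c *\<^sub>C t) v = c *\<^sub>C bracket t (v :: ('a, 'b) tensor)"
  unfolding bracket_tensor_def
  by (simp_all add: clinear_add[OF clinear_tensor_lift[OF cbilinear_bracket_outer]]
      clinear_scale[OF clinear_tensor_lift[OF cbilinear_bracket_outer]])

lemma bracket_tensor_zero_left: "bracket 0 v = (0 :: ('a, 'b) tensor)"
  using bracket_tensor_scale_left[of 0 0 v] by simp

lemma clinear_bracket_pure: "clinear (\<lambda>v. bracket (x \<otimes> s) (v :: ('a, 'b) tensor))"
  unfolding bracket_tensor_def tensor_lift_pure[OF cbilinear_bracket_outer]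
  by (rule clinear_tensor_lift[OF cbilinear_bracket_inner])

lemma bracket_tensor_add_right: "bracket v (t + u) = bracket v t + bracket v (u :: ('a, 'b) tensor)"
  by (induct v rule: tensor_induct)
    (simp_all add: bracket_tensor_add_left bracket_tensor_zero_left
      clinear_add[OF clinear_bracket_pure] algebra_simps)

lemma bracket_tensor_scale_right: "bracket v (c *\<^sub>C t) = c *\<^sub>C bracket v (t :: ('a, 'b) tensor)"
  by (induct v rule: tensor_induct)
    (simp_all add: bracket_tensor_add_left bracket_tensor_zero_left
      clinear_scale[OF clinear_bracket_pure] cscale_add_right)

lemma bracket_tensor_zero_right: "bracket v 0 = (0 :: ('a, 'b) tensor)"
  using bracket_tensor_scale_right[of v 0 0] by simp

lemma pure_tensor_minus_left: "(- x) \<otimes> s = - (x \<otimes> s)"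
  using pure_tensor_scale_left[of "-1" x s] by simp

lemma pure_tensor_zero_left: "0 \<otimes> s = 0"
  using pure_tensor_scale_left[of 0 0 s] by simp

lemma bracket_tensor_antisym: "bracket t u + bracket u t = (0 :: ('a, 'b) tensor)"
proof (induct t rule: tensor_induct)
  case zero
  show ?case by (simp add: bracket_tensor_zero_left bracket_tensor_zero_right)
next
  case (add t t')
  have "bracket (t + t') u + bracket u (t + t') =
      (bracket t u + bracket u t) + (bracket t' u + bracket u t')"
    by (simp add: bracket_tensor_add_left bracket_tensor_add_right)
  then show ?case using add by simp
next
  case (pure x s)
  show ?case
  proof (induct u rule: tensor_induct)
    case zero
    show ?case by (simp add: bracket_tensor_zero_left bracket_tensor_zero_right)
  next
    case (add u u')
    have "bracket (x \<otimes> s) (u + u') + bracket (u + u') (x \<otimes> s) =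
        (bracket (x \<otimes> s) u + bracket u (x \<otimes> s)) + (bracket (x \<otimes> s) u' + bracket u' (x \<otimes> s))"
      by (simp add: bracket_tensor_add_left bracket_tensor_add_right)
    then show ?case using add by simp
  next
    case (pure y r)
    show ?case
      by (subst bracket_pure, subst bracket_pure, subst bracket_antisym)
        (simp add: pure_tensor_minus_left mult.commute)
  qed
qed

instance
proof
  fix t u v :: "('a, 'b) tensor" and c :: complex
  show "bracket (t + u) v = bracket t v + bracket u v" by (rule bracket_tensor_add_left)
  show "bracket t (u + v) = bracket t u + bracket t v" by (rule bracket_tensor_add_right)
  show "bracket (c *\<^sub>C t) u = c *\<^sub>C bracket t u" by (rule bracket_tensor_scale_left)
  show "bracket t (c *\<^sub>C u) = c *\<^sub>C bracket t u" by (rule bracket_tensor_scale_right)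
  note lin = bracket_tensor_add_left bracket_tensor_add_right
    bracket_tensor_zero_left bracket_tensor_zero_right
  show "bracket t t = 0"
  proof (induct t rule: tensor_induct)
    case zero
    show ?case by (rule bracket_tensor_zero_left)
  next
    case (add t u)
    then show ?case using bracket_tensor_antisym[of u t]
      by (simp add: lin)
  next
    case (pure x s)
    show ?case by (simp add: bracket_pure bracket_self pure_tensor_zero_left)
  qed
  let ?J = "\<lambda>t u v :: ('a, 'b) tensor.
    bracket t (bracket u v) + bracket u (bracket v t) + bracket v (bracket t u)"
  have J1: "?J (t + t') u v = ?J t u v + ?J t' u v" for t t' u v by (simp add: lin)
  have J2: "?J t (u + u') v = ?J t u v + ?J t u' v" for t u u' v by (simp add: lin)
  have J3: "?J t u (v + v') = ?J t u v + ?J t u v'" for t u v v' by (simp add: lin)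
  show "?J t u v = 0"
  proof (induct t rule: tensor_induct)
    case zero
    show ?case by (simp add: lin)
  next
    case (add t t')
    then show ?case by (subst J1) simp
  next
    case (pure x s)
    show ?case
    proof (induct u rule: tensor_induct)
      case zero
      show ?case by (simp add: lin)
    next
      case (add u u')
      then show ?case by (subst J2) simp
    next
      case (pure y r)
      show ?case
      proof (induct v rule: tensor_induct)
        case zero
        show ?case by (simp add: lin)
      next
        case (add v v')
        then show ?case by (subst J3) simp
      next
        case (pure z q)
        have "r * (q * s) = s * (r * q)" "q * (s * r) = s * (r * q)"
          by (simp_all add: mult.commute mult.left_commute)
        then show ?case
          by (simp add: bracket_pure pure_tensor_add_left[symmetric] jacobi pure_tensor_zero_left)
      qed
    qed
  qed
qed

end


section \<open>Weight modules\<close>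

definition weight_space ::
  "(('g::complex_lie_algebra, 's::complex_comm_algebra) tensor \<Rightarrow> 'v::complex_vector_space \<Rightarrow> 'v) \<Rightarrow>
   'g set \<Rightarrow> ('g \<Rightarrow> complex) \<Rightarrow> 'v set" where
  "weight_space act H \<mu> = {v. \<forall>h\<in>H. act (h \<otimes> 1) v = \<mu> h *\<^sub>C v}"

definition has_fin_dim_weight_spaces ::
  "(('g::complex_lie_algebra, 's::complex_comm_algebra) tensor \<Rightarrow> 'v::complex_vector_space \<Rightarrow> 'v) \<Rightarrow>
   'g set \<Rightarrow> bool" where
  "has_fin_dim_weight_spaces act H \<longleftrightarrow>
     is_direct_sum (dual_space H) (weight_space act H) \<and>
     (\<forall>\<mu>\<in>dual_space H. fin_dim (weight_space act H \<mu>))"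

text \<open>The subspace \<open>\<gg> \<otimes> I\<close> of \<open>\<gg> \<otimes> S\<close>, for a subspace \<open>I\<close> of \<open>S\<close>.\<close>

definition tensor_subspace ::
  "'s::complex_vector_space set \<Rightarrow> ('g::complex_vector_space, 's) tensor set" where
  "tensor_subspace I = cvec.span {x \<otimes> i | x i. i \<in> I}"

end

theory Submission
  imports Defs
begin

text \<open>
  The kernel of \<open>x \<mapsto> x \<otimes> 1\<close> acting on \<open>V\<close> is an ideal of the simple Lie algebra \<open>\<gg>\<close>. If it is
  all of \<open>\<gg>\<close>, then \<open>\<gg> = [\<gg>, \<gg>]\<close> forces \<open>\<gg> \<otimes> S\<close> to act by zero and \<open>I = S\<close> works
  (\<open>trivial_action_if_not_faithful\<close>). Otherwise \<open>\<gg>\<close> embeds into \<open>End V\<close>, and the structure of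
  \<open>\<gg>\<close> that the proof uses can be read off from this embedding. As \<open>H\<close> acts diagonally on \<open>V\<close>, it is
  abelian. Moreover, the matrix coefficients of \<open>\<gg>\<close> between weight spaces of \<open>V\<close> are linear
  functionals on \<open>\<gg>\<close> that are eigenvectors for the adjoint action of \<open>H\<close>, and they separate the
  points of \<open>\<gg>\<close>. A basis of \<open>\<gg>\<close> dual to finitely many of them therefore consists of root vectors
  (\<open>exists_weight_basis\<close>), and those with root zero lie in \<open>H\<close>, because \<open>H\<close> is self-normalizing.

  Fix a nonzero weight space \<open>V\<^sub>\<mu>\<close>. For a root vector \<open>x\<close> with root \<open>\<alpha> \<noteq> 0\<close>, the elements \<open>s\<close> for
  which \<open>x \<otimes> s\<close> kills \<open>V\<^sub>\<mu>\<close> form an ideal of \<open>S\<close>: choose \<open>h \<in> H\<close> with \<open>\<alpha> h \<noteq> 0\<close>; then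
  \<open>\<alpha> h (x \<otimes> r s) = [h \<otimes> r, x \<otimes> s]\<close>, and \<open>h \<otimes> r\<close> preserves \<open>V\<^sub>\<mu>\<close>, as \<open>H\<close> is abelian.
  This ideal is co-finite because \<open>x \<otimes> s\<close> maps the finite dimensional space \<open>V\<^sub>\<mu>\<close> into the finite dimensional space \<open>V\<^bsub>\<mu>+\<alpha>\<^esub>\<close>. Let
  \<open>J\<close> be the intersection of these ideals over the root vectors in the basis. Since \<open>\<gg>\<close> is simple,
  it is spanned by the root vectors with nonzero roots and the brackets of their combinations
  (\<open>simple_lie_algebra_generated\<close>), so \<open>\<gg> \<otimes> J\<^sup>2\<close> kills \<open>V\<^sub>\<mu>\<close>. The vectors killed by \<open>\<gg> \<otimes> J\<^sup>2\<close> form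
  a submodule, which is everything by irreducibility. Finally, \<open>J\<^sup>2\<close> is co-finite because \<open>S\<close> is
  finitely generated (\<open>cofinite_ideal_square\<close>).
\<close>

section \<open>Direct sums and dual bases\<close>

lemma clinear_zero: "clinear f \<Longrightarrow> f 0 = 0"
  using clinear_scale[of f 0 0] by simp

lemma clinear_sum: "clinear f \<Longrightarrow> f (sum g A) = (\<Sum>a\<in>A. f (g a))"
  by (rule module_hom.sum[where ?s1.0 = cscale and ?s2.0 = cscale]) (simp add: Vector_Spaces.linear_def)

lemma clinear_diff: "clinear f \<Longrightarrow> f (x - y) = f x - f y"
  by (rule module_hom.diff[where ?s1.0 = cscale and ?s2.0 = cscale]) (simp add: Vector_Spaces.linear_def)

lemma subspace_clinear_kernel: "clinear f \<Longrightarrow> cvec.subspace {x. f x = 0}"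
  by (auto simp: cvec.subspace_def clinear_add clinear_scale clinear_zero)

lemma exists_functional_nonzero:
  fixes w :: "'v::complex_vector_space"
  assumes "w \<noteq> 0"
  obtains \<xi> :: "'v \<Rightarrow> complex" where "clinear \<xi>" and "\<xi> w \<noteq> 0"
proof
  have indep: "cvec.independent {w}" using assms by simp
  define B where "B = cvec.extend_basis {w}"
  have B: "cvec.independent B" "cvec.span B = UNIV" "w \<in> B"
    using cvec.independent_extend_basis[OF indep] cvec.span_extend_basis[OF indep]
      cvec.extend_basis_superset[OF indep] by (auto simp: B_def)
  show "clinear (\<lambda>v. cvec.representation B v w)"
    using B by (intro clinearI) (simp_all add: cvec.representation_add cvec.representation_scale
      cscale_complex_def)
  show "cvec.representation B w w \<noteq> 0"
    using B by (simp add: cvec.representation_basis)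
qed

definition decomposition ::
  "'i set \<Rightarrow> ('i \<Rightarrow> 'v::complex_vector_space set) \<Rightarrow> 'v \<Rightarrow> ('i \<Rightarrow> 'v) \<Rightarrow> bool" where
  "decomposition A W v f \<longleftrightarrow> (\<forall>a\<in>A. f a \<in> W a) \<and> (\<forall>a. a \<notin> A \<longrightarrow> f a = 0) \<and>
     finite {a. f a \<noteq> 0} \<and> v = (\<Sum>a | f a \<noteq> 0. f a)"

definition component ::
  "'i set \<Rightarrow> ('i \<Rightarrow> 'v::complex_vector_space set) \<Rightarrow> 'v \<Rightarrow> 'i \<Rightarrow> 'v" where
  "component A W v = (THE f. decomposition A W v f)"

lemma component_decomposition:
  assumes "is_direct_sum A W"
  shows "decomposition A W v (component A W v)"
  unfolding component_def
  by (rule theI'[of "decomposition A W v"])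
    (use assms in \<open>simp add: is_direct_sum_def decomposition_def\<close>)

lemma component_unique:
  assumes "is_direct_sum A W" and "decomposition A W v f"
  shows "component A W v = f"
proof -
  have "\<exists>!f. decomposition A W v f"
    using assms(1) by (simp add: is_direct_sum_def decomposition_def)
  then show ?thesis using component_decomposition[OF assms(1)] assms(2) by blast
qed

lemma decomposition_add:
  assumes "is_direct_sum A W" "decomposition A W v f" "decomposition A W w g"
  shows "decomposition A W (v + w) (\<lambda>a. f a + g a)"
proof -
  define U where "U = {a. f a \<noteq> 0} \<union> {a. g a \<noteq> 0}"
  have U: "finite U" using assms by (simp add: U_def decomposition_def)
  have sub: "cvec.subspace (W a)" if "a \<in> A" for a
    using assms(1) that by (simp add: is_direct_sum_def)
  have "v = sum f U" "w = sum g U"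
    using assms U by (auto simp: decomposition_def U_def intro!: sum.mono_neutral_left)
  moreover have "(\<Sum>a | f a + g a \<noteq> 0. f a + g a) = (\<Sum>a\<in>U. f a + g a)"
    using U by (intro sum.mono_neutral_left) (auto simp: U_def)
  moreover have "finite {a. f a + g a \<noteq> 0}"
    by (rule finite_subset[OF _ U]) (auto simp: U_def)
  ultimately show ?thesis
    using assms sub by (auto simp: decomposition_def sum.distrib cvec.subspace_add)
qed

lemma decomposition_rescale:
  assumes "is_direct_sum A W" "decomposition A W v f"
  shows "decomposition A W (\<Sum>a | f a \<noteq> 0. c a *\<^sub>C f a) (\<lambda>a. c a *\<^sub>C f a)"
proof -
  have fin: "finite {a. f a \<noteq> 0}" using assms by (simp add: decomposition_def)
  have sub: "cvec.subspace (W a)" if "a \<in> A" for a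
    using assms(1) that by (simp add: is_direct_sum_def)
  have "(\<Sum>a | f a \<noteq> 0. c a *\<^sub>C f a) = (\<Sum>a | c a *\<^sub>C f a \<noteq> 0. c a *\<^sub>C f a)"
    using fin by (intro sum.mono_neutral_right) auto
  moreover have "finite {a. c a *\<^sub>C f a \<noteq> 0}"
    by (rule finite_subset[OF _ fin]) auto
  ultimately show ?thesis
    using assms sub by (auto simp: decomposition_def cvec.subspace_scale)
qed

lemma clinear_component:
  assumes "is_direct_sum A W"
  shows "clinear (\<lambda>v. component A W v a)"
proof (rule clinearI)
  note dec = component_decomposition[OF assms]
  show "component A W (v + w) a = component A W v a + component A W w a" for v w
    using component_unique[OF assms decomposition_add[OF assms dec dec]] by simp
  show "component A W (c *\<^sub>C v) a = c *\<^sub>C component A W v a" for c v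
  proof -
    have "c *\<^sub>C v = (\<Sum>a | component A W v a \<noteq> 0. c *\<^sub>C component A W v a)"
      using dec[of v] by (simp add: decomposition_def flip: cvec.scale_sum_right)
    then show ?thesis
      using component_unique[OF assms decomposition_rescale[OF assms dec, of "\<lambda>_. c" v]] by simp
  qed
qed

text \<open>A dual system is a pair of sequences \<open>\<phi>\<^sub>i \<in> \<Phi>\<close> and \<open>y\<^sub>i\<close> with \<open>\<phi>\<^sub>i y\<^sub>j = \<delta>\<^sub>i\<^sub>j\<close>. Its length is bounded by the
  dimension, since the \<open>y\<^sub>i\<close> are independent, and a system of maximal length has trivial joint kernel:
  a nonzero vector in that kernel would be detected by another member of \<open>\<Phi>\<close>, which extends the
  system. Members of \<open>\<Phi>\<close> are used themselves, not linear combinations of them, so that special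
  properties of the functionals (here, being eigenvectors) pass to the dual vectors.\<close>

lemma exists_dual_basis:
  fixes \<Phi> :: "('g::complex_vector_space \<Rightarrow> complex) set"
  assumes fd: "fin_dim (UNIV :: 'g set)"
    and lin: "\<And>\<phi>. \<phi> \<in> \<Phi> \<Longrightarrow> clinear \<phi>"
    and sep: "\<And>x. x \<noteq> 0 \<Longrightarrow> \<exists>\<phi>\<in>\<Phi>. \<phi> x \<noteq> 0"
  obtains n :: nat and \<phi> :: "nat \<Rightarrow> 'g \<Rightarrow> complex" and y :: "nat \<Rightarrow> 'g"
  where "\<And>i. i < n \<Longrightarrow> \<phi> i \<in> \<Phi>"
    and "\<And>i j. i < n \<Longrightarrow> j < n \<Longrightarrow> \<phi> i (y j) = (if i = j then 1 else 0)"
    and "\<And>x. x = (\<Sum>i<n. \<phi> i x *\<^sub>C y i)"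
proof -
  define dual :: "nat \<Rightarrow> (nat \<Rightarrow> 'g \<Rightarrow> complex) \<Rightarrow> (nat \<Rightarrow> 'g) \<Rightarrow> bool" where
    "dual n \<phi> y \<longleftrightarrow> (\<forall>i<n. \<phi> i \<in> \<Phi>) \<and> (\<forall>i<n. \<forall>j<n. \<phi> i (y j) = (if i = j then 1 else 0))"
    for n \<phi> y
  obtain B :: "'g set" where B: "finite B" "cvec.span B = UNIV"
    using fd by (auto simp: fin_dim_def)
  have coeff: "\<phi> j (\<Sum>i<n. c i *\<^sub>C y i) = c j" if "dual n \<phi> y" "j < n" for n \<phi> y c j
  proof -
    have "clinear (\<phi> j)" using that lin by (simp add: dual_def)
    then have "\<phi> j (\<Sum>i<n. c i *\<^sub>C y i) = (\<Sum>i<n. c i * \<phi> j (y i))"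
      by (simp add: clinear_sum clinear_scale cscale_complex_def)
    also have "\<dots> = (\<Sum>i<n. if i = j then c i else 0)"
      using that by (intro sum.cong) (auto simp: dual_def)
    finally show ?thesis using that by simp
  qed
  have bound: "n \<le> card B" if d: "dual n \<phi> y" for n \<phi> y
  proof -
    have inj: "inj_on y {..<n}"
    proof (rule inj_onI)
      fix i j assume "i \<in> {..<n}" "j \<in> {..<n}" "y i = y j"
      then show "i = j" using d unfolding dual_def
        by (metis lessThan_iff zero_neq_one)
    qed
    have "cvec.independent (y ` {..<n})"
    proof (rule cvec.independent_if_scalars_zero)
      fix f x assume z: "(\<Sum>x\<in>y ` {..<n}. f x *\<^sub>C x) = 0" and x: "x \<in> y ` {..<n}"
      from x obtain j where j: "j < n" "x = y j" by auto
      have "(\<Sum>i<n. f (y i) *\<^sub>C y i) = 0"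
        using z by (simp add: sum.reindex[OF inj])
      then have "f (y j) = \<phi> j 0"
        using coeff[OF d j(1), of "\<lambda>i. f (y i)"] by simp
      then show "f x = 0" using d lin j by (simp add: dual_def clinear_zero)
    qed simp
    then have "card (y ` {..<n}) \<le> card B"
      using cvec.independent_span_bound[OF B(1)] B(2) by blast
    then show ?thesis by (simp add: card_image[OF inj])
  qed
  define P where "P n \<longleftrightarrow> (\<exists>\<phi> y. dual n \<phi> y)" for n
  have P0: "P 0" by (auto simp: P_def dual_def)
  have Pb: "P n \<Longrightarrow> n \<le> card B" for n using bound by (auto simp: P_def)
  define n where "n = (GREATEST n. P n)"
  have Pn: "P n" unfolding n_def using P0 Pb by (rule GreatestI_nat)
  have max: "P m \<Longrightarrow> m \<le> n" for m unfolding n_def by (rule Greatest_le_nat[OF _ Pb])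
  from Pn obtain \<phi> y where d: "dual n \<phi> y" by (auto simp: P_def)
  have kernel: "x = 0" if x: "\<And>i. i < n \<Longrightarrow> \<phi> i x = 0" for x
  proof (rule ccontr)
    assume "x \<noteq> 0"
    from sep[OF this] obtain \<psi> where \<psi>: "\<psi> \<in> \<Phi>" "\<psi> x \<noteq> 0" by blast
    define u where "u = inverse (\<psi> x) *\<^sub>C x"
    have u: "\<psi> u = 1" using \<psi> lin by (simp add: u_def clinear_scale cscale_complex_def)
    have u0: "\<phi> i u = 0" if "i < n" for i
      using that x d lin by (simp add: u_def clinear_scale dual_def cscale_complex_def)
    \<comment> \<open>Correct the old vectors by multiples of \<open>u\<close> so that the new functional kills them.\<close>
    have "dual (Suc n) (\<phi>(n := \<psi>)) ((\<lambda>i. y i - \<psi> (y i) *\<^sub>C u)(n := u))"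
      using d \<psi> u u0 lin
      by (auto simp: dual_def less_Suc_eq clinear_diff clinear_scale cscale_complex_def)
    then have "P (Suc n)" by (auto simp: P_def)
    then show False using max[of "Suc n"] by simp
  qed
  show ?thesis
  proof
    show "\<phi> i \<in> \<Phi>" if "i < n" for i using d that by (simp add: dual_def)
    show "\<phi> i (y j) = (if i = j then 1 else 0)" if "i < n" "j < n" for i j
      using d that by (simp add: dual_def)
    fix x
    have "x - (\<Sum>i<n. \<phi> i x *\<^sub>C y i) = 0"
      by (rule kernel) (use d lin coeff[OF d] in \<open>simp add: clinear_diff dual_def\<close>)
    then show "x = (\<Sum>i<n. \<phi> i x *\<^sub>C y i)" by simp
  qed
qed


section \<open>Subspaces of finite codimension\<close>

lemma cofinite_UNIV: "cofinite_in UNIV"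
  unfolding cofinite_in_def by (rule exI[of _ "{}"]) auto

text \<open>Passing to the kernel of one functional raises the codimension by at most one: a single
  vector \<open>u \<in> I\<close> with \<open>\<phi> u \<noteq> 0\<close> is added to the representatives.\<close>

lemma cofinite_Int_functional_kernel:
  fixes \<phi> :: "'s::complex_vector_space \<Rightarrow> complex"
  assumes sub: "cvec.subspace I" and cof: "cofinite_in I" and lin: "clinear \<phi>"
  shows "cofinite_in {s \<in> I. \<phi> s = 0}"
proof (cases "\<forall>s\<in>I. \<phi> s = 0")
  case True
  then have "{s \<in> I. \<phi> s = 0} = I" by auto
  then show ?thesis using cof by simp
next
  case False
  then obtain u where u: "u \<in> I" "\<phi> u \<noteq> 0" by blast
  obtain B where B: "finite B" "\<And>s. \<exists>b\<in>cvec.span B. s - b \<in> I"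
    using cof by (auto simp: cofinite_in_def)
  have "\<exists>b\<in>cvec.span (insert u B). s - b \<in> {s \<in> I. \<phi> s = 0}" for s
  proof -
    obtain b where b: "b \<in> cvec.span B" "s - b \<in> I" using B(2) by blast
    define c where "c = \<phi> (s - b) / \<phi> u"
    have "b + c *\<^sub>C u \<in> cvec.span (insert u B)"
      using b(1) cvec.span_mono[OF subset_insertI, of B u]
      by (intro cvec.span_add cvec.span_scale) (auto intro: cvec.span_base)
    moreover have "s - (b + c *\<^sub>C u) = (s - b) - c *\<^sub>C u" by simp
    moreover have "(s - b) - c *\<^sub>C u \<in> I"
      using cvec.subspace_diff[OF sub b(2) cvec.subspace_scale[OF sub u(1)]] .
    moreover have "\<phi> ((s - b) - c *\<^sub>C u) = 0"
      using u lin by (simp add: c_def clinear_diff[of \<phi> "s - b"] clinear_scale cscale_complex_def)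
    ultimately show ?thesis by (metis (mono_tags, lifting) mem_Collect_eq)
  qed
  then show ?thesis unfolding cofinite_in_def using B(1) by (meson finite_insert)
qed

lemma cofinite_Int_kernel:
  fixes f :: "'s::complex_vector_space \<Rightarrow> 'w::complex_vector_space"
  assumes sub: "cvec.subspace I" and cof: "cofinite_in I" and lin: "clinear f"
    and fd: "fin_dim W" and range: "\<And>s. f s \<in> W"
  shows "cofinite_in {s \<in> I. f s = 0}"
proof -
  obtain B0 where B0: "finite B0" "cvec.span B0 = W" using fd by (auto simp: fin_dim_def)
  obtain B where B: "B \<subseteq> B0" "cvec.independent B" "cvec.span B = W"
    using cvec.maximal_independent_subset[of B0] B0(2) cvec.span_mono cvec.span_minimal
    by (metis cvec.subspace_span subset_antisym)
  have finB: "finite B" using B(1) B0(1) by (rule finite_subset)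
  define coord where "coord b s = cvec.representation B (f s) b" for b s
  have coord: "clinear (coord b)" for b
    using B range lin
    by (intro clinearI) (simp_all add: coord_def clinear_add clinear_scale
      cvec.representation_add cvec.representation_scale cscale_complex_def)
  have "cofinite_in {s \<in> I. \<forall>b\<in>C. coord b s = 0}" if "finite C" for C
    using that
  proof induct
    case empty
    then show ?case using cof by simp
  next
    case (insert b C)
    have "cvec.subspace {s \<in> I. \<forall>b\<in>C. coord b s = 0}"
      using sub coord by (auto simp: cvec.subspace_def clinear_add clinear_scale clinear_zero)
    from cofinite_Int_functional_kernel[OF this insert(3) coord[of b]]
    show ?case by (rule back_subst[of cofinite_in]) auto
  qed
  from this[OF finB] show ?thesis
  proof (rule back_subst[of cofinite_in])
    have "f s = 0 \<longleftrightarrow> (\<forall>b\<in>B. coord b s = 0)" for s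
    proof
      assume "\<forall>b\<in>B. coord b s = 0"
      moreover have "f s = (\<Sum>b\<in>B. coord b s *\<^sub>C b)"
        unfolding coord_def
        using cvec.sum_representation_eq[OF B(2) _ finB, of "f s" ] B(3) range by auto
      ultimately show "f s = 0" by simp
    qed (simp add: coord_def cvec.representation_zero)
    then show "{s \<in> I. \<forall>b\<in>B. coord b s = 0} = {s \<in> I. f s = 0}" by blast
  qed
qed

lemma cofinite_INT_kernels:
  fixes f :: "'k \<Rightarrow> 's::complex_vector_space \<Rightarrow> 'w::complex_vector_space"
  assumes "finite K" and "\<And>k. k \<in> K \<Longrightarrow> clinear (f k)"
    and "\<And>k. k \<in> K \<Longrightarrow> fin_dim (W k)" and "\<And>k s. k \<in> K \<Longrightarrow> f k s \<in> W k"
  shows "cofinite_in {s. \<forall>k\<in>K. f k s = 0}"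
  using assms
proof (induct K)
  case empty
  then show ?case by (simp add: cofinite_UNIV)
next
  case (insert k K)
  have "cvec.subspace {s. \<forall>k\<in>K. f k s = 0}"
    using insert.prems by (auto simp: cvec.subspace_def clinear_add clinear_scale clinear_zero)
  then have "cofinite_in {s \<in> {s. \<forall>k\<in>K. f k s = 0}. f k s = 0}"
    using insert by (intro cofinite_Int_kernel[where W = "W k"]) auto
  then show ?case by (rule back_subst[of cofinite_in]) auto
qed


section \<open>Squares of co-finite ideals\<close>

definition ideal_square :: "'s::complex_comm_algebra set \<Rightarrow> 's set" where
  "ideal_square I = cvec.span {s * t | s t. s \<in> I \<and> t \<in> I}"

lemma clinear_mult: "clinear (\<lambda>s. r * (s::'s::complex_comm_algebra))"
  by (rule clinearI) (simp_all add: distrib_left cscale_mult_right)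

lemma span_closed_under_linear:
  assumes "clinear f" and "\<And>x. x \<in> X \<Longrightarrow> f x \<in> cvec.span Y" and "x \<in> cvec.span X"
  shows "f x \<in> cvec.span Y"
  using assms(3)
proof (induct rule: cvec.span_induct_alt)
  case base
  then show ?case by (simp add: clinear_zero[OF assms(1)] cvec.span_zero)
next
  case (step c x y)
  then show ?case
    using assms by (simp add: clinear_add clinear_scale cvec.span_add cvec.span_scale)
qed

lemma ideal_square_ideal:
  assumes "is_alg_ideal I"
  shows "is_alg_ideal (ideal_square I)"
proof -
  have "r * s \<in> ideal_square I" if "s \<in> ideal_square I" for r s
    using that unfolding ideal_square_def
  proof (rule span_closed_under_linear[OF clinear_mult, rotated])
    fix x assume "x \<in> {s * t | s t. s \<in> I \<and> t \<in> I}"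
    then obtain s t where "x = s * t" "s \<in> I" "t \<in> I" by blast
    then have "r * x = (r * s) * t" "r * s \<in> I"
      using assms by (simp_all add: mult.assoc is_alg_ideal_def)
    then show "r * x \<in> cvec.span {s * t | s t. s \<in> I \<and> t \<in> I}"
      using \<open>t \<in> I\<close> by (intro cvec.span_base) blast
  qed
  then show ?thesis by (simp add: is_alg_ideal_def ideal_square_def)
qed

lemma fin_gen_algebra_induct:
  assumes "\<forall>a\<in>F. P a" and "is_subalgebra hull F = (UNIV :: 's::complex_comm_algebra set)"
    and "is_subalgebra {a. P a}"
  shows "P a"
proof -
  have "is_subalgebra hull F \<subseteq> {a. P a}" using assms by (intro hull_minimal) auto
  then show ?thesis using assms(2) by auto
qed

text \<open>Let \<open>B\<close> be a finite set containing \<open>1\<close> that spans \<open>S\<close> modulo \<open>I\<close>. Multiplying an element of \<open>B\<close>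
  by a generator of \<open>S\<close> leads back to the span of \<open>B\<close> up to one of finitely many errors in \<open>I\<close>; let
  \<open>E\<close> be the set of these errors. Then \<open>span B + S E\<close> contains \<open>1\<close> and is stable under the generators,
  so it is \<open>S\<close>. Writing the coefficients in \<open>S E\<close> as elements of \<open>span B + I\<close> yields
  \<open>S = span B + span (B E) + I\<^sup>2\<close>.\<close>

lemma cofinite_ideal_square:
  fixes I :: "'s::complex_comm_algebra set"
  assumes fg: "fin_gen_algebra TYPE('s)" and ideal: "is_alg_ideal I" and cof: "cofinite_in I"
  shows "cofinite_in (ideal_square I)"
proof -
  obtain F :: "'s set" where F: "finite F" "is_subalgebra hull F = UNIV"
    using fg by (auto simp: fin_gen_algebra_def)
  obtain B0 where B0: "finite B0" "\<And>s. \<exists>b\<in>cvec.span B0. s - b \<in> I"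
    using cof by (auto simp: cofinite_in_def)
  define B where "B = insert 1 B0"
  have B: "finite B" "1 \<in> B" using B0 by (auto simp: B_def)
  have "\<exists>b. b \<in> cvec.span B \<and> s - b \<in> I" for s
    using B0(2)[of s] cvec.span_mono[of B0 B] by (auto simp: B_def)
  then obtain rd where rd: "\<And>s. rd s \<in> cvec.span B" "\<And>s. s - rd s \<in> I"
    by metis
  define E where "E = (\<lambda>(a, b). a * b - rd (a * b)) ` (F \<times> B)"
  have E: "finite E" "E \<subseteq> I" using F B rd(2) by (auto simp: E_def)
  \<comment> \<open>The span of \<open>B\<close> plus the ideal generated by the reduction errors in \<open>E\<close>.\<close>
  define W where "W = cvec.span (B \<union> {r * e | r e. e \<in> E})"
  define T where "T = {a. \<forall>w\<in>W. a * w \<in> W}"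
  have "a \<in> T" for a
  proof (rule fin_gen_algebra_induct[OF _ F(2), of "\<lambda>a. a \<in> T"], goal_cases)
    case 1
    show ?case
    proof
      fix a assume a: "a \<in> F"
      have "a * w \<in> W" if "w \<in> W" for w
        using that unfolding W_def
      proof (rule span_closed_under_linear[OF clinear_mult, rotated])
        fix x assume "x \<in> B \<union> {r * e | r e. e \<in> E}"
        then show "a * x \<in> cvec.span (B \<union> {r * e | r e. e \<in> E})"
        proof
          assume x: "x \<in> B"
          have "a * x - rd (a * x) \<in> E"
            using a x by (auto simp: E_def)
          then have "1 * (a * x - rd (a * x)) \<in> cvec.span (B \<union> {r * e | r e. e \<in> E})"
            by (intro cvec.span_base) blast
          moreover have "rd (a * x) \<in> cvec.span (B \<union> {r * e | r e. e \<in> E})"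
            using rd(1) cvec.span_mono[of B] by blast
          ultimately show ?thesis
            using cvec.span_add by fastforce
        next
          assume "x \<in> {r * e | r e. e \<in> E}"
          then obtain r e where "x = r * e" "e \<in> E" by blast
          then have "a * x = (a * r) * e" "e \<in> E" by (simp_all add: mult.assoc)
          then show ?thesis by (intro cvec.span_base) blast
        qed
      qed
      then show "a \<in> T" by (simp add: T_def)
    qed
  next
    case 2
    show ?case
      by (auto simp: T_def is_subalgebra_def cvec.subspace_def W_def distrib_right cscale_mult_left
        cvec.span_add cvec.span_scale cvec.span_zero mult.assoc)
  qed
  moreover have "1 \<in> W" using B by (auto simp: W_def intro: cvec.span_base)
  ultimately have W: "s \<in> W" for s
    using bspec[of W "\<lambda>w. s * w \<in> W" 1] by (simp add: T_def)
  define C where "C = B \<union> (\<lambda>(b, e). b * e) ` (B \<times> E)"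
  have finC: "finite C" using B E by (simp add: C_def)
  define G where "G = C \<union> {s * t | s t. s \<in> I \<and> t \<in> I}"
  have 1: "s \<in> cvec.span G" for s
    using W[of s] unfolding W_def
  proof (rule span_closed_under_linear[of "\<lambda>x. x", rotated 2])
    show "clinear (\<lambda>x::'s. x)" by (rule clinearI) auto
    fix x assume "x \<in> B \<union> {r * e | r e. e \<in> E}"
    then show "x \<in> cvec.span G"
    proof
      assume "x \<in> B"
      then show ?thesis by (auto simp: G_def C_def intro: cvec.span_base)
    next
      assume "x \<in> {r * e | r e. e \<in> E}"
      then obtain r e where x: "x = r * e" "e \<in> E" by blast
      have "(r - rd r) * e \<in> cvec.span G"
        using rd(2)[of r] x E by (intro cvec.span_base) (auto simp: G_def)
      moreover have "e * rd r \<in> cvec.span G"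
        by (rule span_closed_under_linear[OF clinear_mult _ rd(1)], rule cvec.span_base)
          (use x in \<open>force simp: G_def C_def mult.commute\<close>)
      moreover have "x = (r - rd r) * e + e * rd r"
        by (simp add: x algebra_simps)
      ultimately show ?thesis using cvec.span_add by simp
    qed
  qed
  have "\<exists>b\<in>cvec.span C. s - b \<in> ideal_square I" for s
    using 1[of s] unfolding G_def cvec.span_Un ideal_square_def by force
  then show ?thesis using finC by (auto simp: cofinite_in_def)
qed


section \<open>Simple Lie algebras\<close>

lemma clinear_bracket: "clinear (bracket (x :: 'g::complex_lie_algebra))"
  by (rule clinearI) (simp_all add: bracket_add_right bracket_scale_right)

lemma jacobi_derivation:
  "bracket x (bracket y z) = bracket (bracket x y) z + bracket y (bracket x (z::'g::complex_lie_algebra))"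
proof -
  have "bracket x (bracket y z) = - bracket z (bracket x y) - bracket y (bracket z x)"
    using jacobi[of x y z] by (simp add: eq_neg_iff_add_eq_0 algebra_simps)
  also have "bracket z (bracket x y) = - bracket (bracket x y) z"
    by (rule bracket_antisym)
  also have "bracket z x = - bracket x z" by (rule bracket_antisym)
  also have "bracket y (- bracket x z) = - bracket y (bracket x z)"
    using bracket_scale_right[of y "-1" "bracket x z"] by simp
  finally show ?thesis by simp
qed

lemma simple_ideal_UNIV:
  assumes "simple_lie_algebra TYPE('g::complex_lie_algebra)" and "is_lie_ideal J"
    and "x \<in> J" and "x \<noteq> (0::'g)"
  shows "J = UNIV"
  using assms unfolding simple_lie_algebra_def by blast

lemma simple_lie_algebra_perfect:
  assumes "simple_lie_algebra TYPE('g::complex_lie_algebra)"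
  shows "cvec.span {bracket x y | x y. True} = (UNIV :: 'g set)"
proof -
  obtain x y :: 'g where "bracket x y \<noteq> 0"
    using assms by (auto simp: simple_lie_algebra_def)
  moreover have "bracket x y \<in> cvec.span {bracket x y | x y. True}"
    by (rule cvec.span_base) blast
  moreover have "is_lie_ideal (cvec.span {bracket x y | x (y::'g). True})"
    by (auto simp: is_lie_ideal_def intro: cvec.span_base)
  ultimately show ?thesis using simple_ideal_UNIV[OF assms] by blast
qed

text \<open>The span of \<open>R\<close> and \<open>[R, R]\<close> is an ideal: it is stable under \<open>ad H\<close>, as \<open>R\<close> is, and under \<open>ad R\<close>,
  because \<open>[R, \<gg>] \<subseteq> [R, H] + [R, R]\<close>. It is nonzero, because \<open>R = {0}\<close> would make \<open>\<gg> = H\<close> abelian.\<close>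

lemma simple_lie_algebra_generated:
  fixes H R :: "'g::complex_lie_algebra set"
  assumes simple: "simple_lie_algebra TYPE('g)"
    and R: "cvec.subspace R"
    and abelian: "\<And>h h'. h \<in> H \<Longrightarrow> h' \<in> H \<Longrightarrow> bracket h h' = 0"
    and HR: "\<And>h r. h \<in> H \<Longrightarrow> r \<in> R \<Longrightarrow> bracket h r \<in> R"
    and sum: "\<And>x. \<exists>h\<in>H. \<exists>r\<in>R. x = h + r"
  shows "cvec.span (R \<union> {bracket r r' | r r'. r \<in> R \<and> r' \<in> R}) = UNIV" (is "cvec.span ?G = _")
proof -
  have RR: "bracket r r' \<in> cvec.span ?G" if "r \<in> R" "r' \<in> R" for r r'
    using that by (intro cvec.span_base) blast
  have H: "bracket h y \<in> cvec.span ?G" if h: "h \<in> H" and y: "y \<in> cvec.span ?G" for h y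
    using y
  proof (rule span_closed_under_linear[OF clinear_bracket, rotated])
    fix x assume "x \<in> ?G"
    then show "bracket h x \<in> cvec.span ?G"
    proof
      assume "x \<in> R"
      then show ?thesis using HR[OF h] by (intro cvec.span_base) blast
    next
      assume "x \<in> {bracket r r' | r r'. r \<in> R \<and> r' \<in> R}"
      then obtain r r' where x: "x = bracket r r'" "r \<in> R" "r' \<in> R" by blast
      show ?thesis
        using x HR[OF h] by (simp add: jacobi_derivation[of h r r'] cvec.span_add RR)
    qed
  qed
  have R': "bracket r x \<in> cvec.span ?G" if r: "r \<in> R" for r x
  proof -
    obtain h r' where x: "h \<in> H" "r' \<in> R" "x = h + r'" using sum by blast
    have "bracket r h = - bracket h r" by (rule bracket_antisym)
    moreover have "bracket h r \<in> cvec.span ?G"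
      using HR x r by (intro cvec.span_base) blast
    ultimately show ?thesis
      using RR[OF r x(2)] by (simp add: x(3) bracket_add_right cvec.span_diff)
  qed
  have ideal: "is_lie_ideal (cvec.span ?G)"
    unfolding is_lie_ideal_def
  proof (intro conjI allI ballI)
    fix x y assume y: "y \<in> cvec.span ?G"
    obtain h r where x: "h \<in> H" "r \<in> R" "x = h + r" using sum by blast
    show "bracket x y \<in> cvec.span ?G"
      using H[OF x(1) y] R'[OF x(2)] by (simp add: x(3) bracket_add_left cvec.span_add)
  qed (rule cvec.subspace_span)
  obtain r where "r \<in> R" "r \<noteq> 0"
  proof (rule ccontr)
    assume "\<not> thesis"
    then have "R \<subseteq> {0}" using that by blast
    then have "x \<in> H" for x using sum[of x] by auto
    then show False
      using simple abelian by (auto simp: simple_lie_algebra_def)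
  qed
  then show ?thesis
    using simple_ideal_UNIV[OF simple ideal, of r] by (auto intro: cvec.span_base)
qed


section \<open>Weight modules\<close>

lemma clinear_act: "lie_module act \<Longrightarrow> clinear (act a)"
  and clinear_act_left: "lie_module act \<Longrightarrow> clinear (\<lambda>a. act a v)"
  by (auto simp: lie_module_def cbilinear_def)

lemma act_bracket: "lie_module act \<Longrightarrow> act (bracket a b) v = act a (act b v) - act b (act a v)"
  by (simp add: lie_module_def)

lemma clinear_act_pure_left: "lie_module act \<Longrightarrow> clinear (\<lambda>x. act (x \<otimes> s) v)"
  by (rule clinearI)
    (simp_all add: pure_tensor_add_left pure_tensor_scale_left
      clinear_add[OF clinear_act_left] clinear_scale[OF clinear_act_left])

lemma clinear_act_pure_right: "lie_module act \<Longrightarrow> clinear (\<lambda>s. act (x \<otimes> s) v)"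
  by (rule clinearI)
    (simp_all add: pure_tensor_add_right pure_tensor_scale_right
      clinear_add[OF clinear_act_left] clinear_scale[OF clinear_act_left])

lemma act_bracket_pure:
  "lie_module act \<Longrightarrow>
   act (bracket x y \<otimes> (s * t)) v = act (x \<otimes> s) (act (y \<otimes> t) v) - act (y \<otimes> t) (act (x \<otimes> s) v)"
  by (simp add: act_bracket flip: bracket_pure)

lemma act_subspace_zero:
  assumes "lie_module act" and "\<And>x s. x \<in> X \<Longrightarrow> s \<in> Y \<Longrightarrow> act (x \<otimes> s) v = 0"
    and "x \<in> cvec.span X" and "s \<in> cvec.span Y"
  shows "act (x \<otimes> s) v = 0"
proof -
  have "act (x \<otimes> s) v = 0" if "x \<in> X" for x
  proof -
    have "cvec.span Y \<subseteq> {s. act (x \<otimes> s) v = 0}"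
      using assms(1,2) that
      by (intro cvec.span_minimal subspace_clinear_kernel clinear_act_pure_right) auto
    then show ?thesis using assms(4) by blast
  qed
  then have "cvec.span X \<subseteq> {x. act (x \<otimes> s) v = 0}"
    using assms(1)
    by (intro cvec.span_minimal subspace_clinear_kernel clinear_act_pure_left) auto
  then show ?thesis using assms(3) by blast
qed

text \<open>If \<open>\<gg> \<otimes> I\<close> kills \<open>v\<close>, then \<open>(x \<otimes> s) (y \<otimes> r) v = (y \<otimes> r) (x \<otimes> s) v + ([x, y] \<otimes> s r) v = 0\<close> for
  \<open>s \<in> I\<close>, since \<open>s r \<in> I\<close>.\<close>

lemma annihilated_submodule:
  fixes act :: "('g::complex_lie_algebra, 's::complex_comm_algebra) tensor \<Rightarrow> 'v::complex_vector_space \<Rightarrow> 'v"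
  assumes module: "lie_module act" and ideal: "is_alg_ideal I"
  shows "is_submodule act {v. \<forall>x. \<forall>s\<in>I. act (x \<otimes> s) v = 0}" (is "is_submodule act ?N")
  unfolding is_submodule_def
proof (intro conjI allI ballI)
  note lin = clinear_act[OF module]
  show sub: "cvec.subspace ?N"
    by (simp add: cvec.subspace_def lin[THEN clinear_add] lin[THEN clinear_scale]
      lin[THEN clinear_zero])
  fix a v assume v: "v \<in> ?N"
  show "act a v \<in> ?N"
  proof (induct a rule: tensor_induct)
    case zero
    show ?case using clinear_zero[OF clinear_act_left[OF module]] cvec.subspace_0[OF sub] by simp
  next
    case (add t u)
    have "act (t + u) v = act t v + act u v"
      by (rule clinear_add[OF clinear_act_left[OF module]])
    then show ?case using cvec.subspace_add[OF sub add] by simp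
  next
    case (pure y r)
    have "act (x \<otimes> s) (act (y \<otimes> r) v) = 0" if s: "s \<in> I" for x s
    proof -
      have "s * r \<in> I"
        using ideal s by (metis is_alg_ideal_def mult.commute)
      then have "act (bracket x y \<otimes> (s * r)) v = 0" and "act (x \<otimes> s) v = 0"
        using v s by auto
      then show ?thesis
        using clinear_zero[OF clinear_act[OF module]] by (simp add: act_bracket_pure[OF module])
    qed
    then show ?case by simp
  qed
qed

locale faithful_weight_module =
  fixes H :: "'g::complex_lie_algebra set"
    and act :: "('g, 's::complex_comm_algebra) tensor \<Rightarrow> 'v::complex_vector_space \<Rightarrow> 'v"
  assumes fin_dim_g: "fin_dim (UNIV :: 'g set)"
    and cartan: "is_cartan_subalgebra H"
    and module: "lie_module act"
    and weights: "has_fin_dim_weight_spaces act H"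
    and faithful: "\<And>x. (\<And>v. act (x \<otimes> 1) v = 0) \<Longrightarrow> x = 0"
begin

abbreviation wt :: "('g \<Rightarrow> complex) \<Rightarrow> 'v set" where
  "wt \<equiv> weight_space act H"

abbreviation proj :: "'v \<Rightarrow> ('g \<Rightarrow> complex) \<Rightarrow> 'v" where
  "proj \<equiv> component (dual_space H) wt"

lemmas act_scale = clinear_scale[OF clinear_act[OF module]]
  and act_zero = clinear_zero[OF clinear_act[OF module]]
  and act_sum = clinear_sum[OF clinear_act[OF module]]

lemma direct_sum: "is_direct_sum (dual_space H) wt"
  using weights by (simp add: has_fin_dim_weight_spaces_def)

lemma proj_mem: "\<mu> \<in> dual_space H \<Longrightarrow> proj v \<mu> \<in> wt \<mu>"
  and proj_outside: "\<mu> \<notin> dual_space H \<Longrightarrow> proj v \<mu> = 0"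
  and proj_sum: "v = (\<Sum>\<mu> | proj v \<mu> \<noteq> 0. proj v \<mu>)"
  using component_decomposition[OF direct_sum] unfolding decomposition_def by blast+

lemma clinear_eq_zero_if_weight_vectors:
  assumes "clinear f" and "\<And>\<mu> v. \<mu> \<in> dual_space H \<Longrightarrow> v \<in> wt \<mu> \<Longrightarrow> f v = 0"
  shows "f v = 0"
proof -
  have "f v = (\<Sum>\<mu> | proj v \<mu> \<noteq> 0. f (proj v \<mu>))"
    using proj_sum[of v] clinear_sum[OF assms(1)] by metis
  also have "\<dots> = 0"
    using assms(2)[OF _ proj_mem] proj_outside by (intro sum.neutral) blast
  finally show ?thesis .
qed

lemma proj_act:
  assumes h: "h \<in> H"
  shows "proj (act (h \<otimes> 1) v) \<mu> = \<mu> h *\<^sub>C proj v \<mu>"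
proof -
  have "act (h \<otimes> 1) v = (\<Sum>\<mu> | proj v \<mu> \<noteq> 0. act (h \<otimes> 1) (proj v \<mu>))"
    using proj_sum[of v] act_sum by metis
  also have "\<dots> = (\<Sum>\<mu> | proj v \<mu> \<noteq> 0. \<mu> h *\<^sub>C proj v \<mu>)"
  proof (rule sum.cong[OF refl])
    fix \<mu> assume "\<mu> \<in> {\<mu>. proj v \<mu> \<noteq> 0}"
    then have "proj v \<mu> \<in> wt \<mu>" using proj_mem proj_outside by blast
    then show "act (h \<otimes> 1) (proj v \<mu>) = \<mu> h *\<^sub>C proj v \<mu>"
      using h by (simp add: weight_space_def)
  qed
  finally show ?thesis
    using component_unique[OF direct_sum decomposition_rescale[OF direct_sum
      component_decomposition[OF direct_sum], of "\<lambda>\<mu>. \<mu> h" v]] by simp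
qed

text \<open>Elements of \<open>H\<close> act on each weight space by scalars, so their commutator acts by zero; now use
  faithfulness.\<close>

lemma cartan_abelian:
  assumes "h \<in> H" "h' \<in> H"
  shows "bracket h h' = 0"
proof (rule faithful)
  fix v
  have "act (bracket h h' \<otimes> (1 * 1)) v = 0"
  proof (rule clinear_eq_zero_if_weight_vectors[OF clinear_act[OF module]])
    fix \<mu> v assume "v \<in> wt \<mu>"
    then show "act (bracket h h' \<otimes> (1 * 1)) v = 0"
      using assms
      by (simp only: act_bracket_pure[OF module])
        (simp add: weight_space_def act_scale cscale_cscale mult.commute)
  qed
  then show "act (bracket h h' \<otimes> 1) v = 0" by simp
qed

text \<open>Zero, or an eigenvector of the adjoint action of \<open>H\<close> on the dual space of \<open>\<gg>\<close>, up to the sign of the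
  eigenvalue \<open>\<alpha>\<close>.\<close>

definition weight_functional :: "('g \<Rightarrow> complex) \<Rightarrow> bool" where
  "weight_functional \<phi> \<longleftrightarrow> clinear \<phi> \<and> (\<exists>\<alpha>. \<forall>h\<in>H. \<forall>x. \<phi> (bracket h x) = \<alpha> h * \<phi> x)"

text \<open>For \<open>v\<close> of weight \<open>\<mu>\<close> and a functional \<open>\<xi>\<close> on \<open>V\<close> composed with the projection to the weight space
  of \<open>\<nu>\<close>, the matrix coefficient \<open>x \<mapsto> \<xi> (x v)\<^sub>\<nu>\<close> is a weight functional with eigenvalue \<open>\<nu> - \<mu>\<close>.
  If all of them vanish at \<open>x\<close>, then \<open>x \<otimes> 1\<close> acts by zero.\<close>

lemma weight_functionals_separate:
  assumes "x \<noteq> 0"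
  shows "\<exists>\<phi>\<in>Collect weight_functional. \<phi> x \<noteq> 0"
proof -
  obtain \<mu> v where v: "v \<in> wt \<mu>" and xv: "act (x \<otimes> 1) v \<noteq> 0"
    using clinear_eq_zero_if_weight_vectors[OF clinear_act[OF module]] faithful assms by metis
  have "\<exists>\<nu>. proj (act (x \<otimes> 1) v) \<nu> \<noteq> 0"
    using proj_sum[of "act (x \<otimes> 1) v"] xv by (auto intro: ccontr)
  then obtain \<nu> where \<nu>: "proj (act (x \<otimes> 1) v) \<nu> \<noteq> 0" by blast
  obtain \<xi> :: "'v \<Rightarrow> complex" where \<xi>: "clinear \<xi>" "\<xi> (proj (act (x \<otimes> 1) v) \<nu>) \<noteq> 0"
    by (rule exists_functional_nonzero[OF \<nu>])
  define \<phi> where "\<phi> y = \<xi> (proj (act (y \<otimes> 1) v) \<nu>)" for y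
  note lin = \<xi>(1) clinear_component[OF direct_sum, of \<nu>] clinear_act_pure_left[OF module, of 1 v]
  have "clinear \<phi>"
    by (rule clinearI) (simp_all add: \<phi>_def lin[THEN clinear_add] lin[THEN clinear_scale])
  moreover have "\<phi> (bracket h y) = (\<nu> h - \<mu> h) * \<phi> y" if h: "h \<in> H" for h y
  proof -
    have "act (bracket h y \<otimes> (1 * 1)) v
        = act (h \<otimes> 1) (act (y \<otimes> 1) v) - \<mu> h *\<^sub>C act (y \<otimes> 1) v"
      using v h by (simp only: act_bracket_pure[OF module]) (simp add: weight_space_def act_scale)
    then show ?thesis
      using proj_act[OF h, of "act (y \<otimes> 1) v" \<nu>]
      by (simp add: \<phi>_def lin[THEN clinear_diff] lin[THEN clinear_scale] cscale_complex_def
        left_diff_distrib)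
  qed
  ultimately have "weight_functional \<phi>"
    unfolding weight_functional_def by (intro conjI exI[of _ "\<lambda>h. \<nu> h - \<mu> h"]) auto
  moreover have "\<phi> x \<noteq> 0" using \<xi>(2) by (simp add: \<phi>_def)
  ultimately show ?thesis by blast
qed

text \<open>In a basis \<open>y\<close> dual to weight functionals \<open>\<phi>\<close>, the coordinates of \<open>[h, y\<^sub>i]\<close> are
  \<open>\<phi>\<^sub>j [h, y\<^sub>i] = c \<phi>\<^sub>j y\<^sub>i\<close> for a scalar \<open>c\<close>, so only the \<open>i\<close>-th one can be nonzero.\<close>

lemma exists_weight_basis:
  obtains n :: nat and y :: "nat \<Rightarrow> 'g" and \<alpha> :: "nat \<Rightarrow> 'g \<Rightarrow> complex"
  where "\<And>i. i < n \<Longrightarrow> \<alpha> i \<in> dual_space H"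
    and "\<And>i h. i < n \<Longrightarrow> h \<in> H \<Longrightarrow> bracket h (y i) = \<alpha> i h *\<^sub>C y i"
    and "cvec.span (y ` {..<n}) = UNIV"
proof -
  obtain n \<phi> and y :: "nat \<Rightarrow> 'g"
    where \<phi>: "\<And>i. i < n \<Longrightarrow> \<phi> i \<in> Collect weight_functional"
      and dual: "\<And>i j. i < n \<Longrightarrow> j < n \<Longrightarrow> \<phi> i (y j) = (if i = j then 1 else 0)"
      and expand: "\<And>x. x = (\<Sum>i<n. \<phi> i x *\<^sub>C y i)"
    by (rule exists_dual_basis[OF fin_dim_g _ weight_functionals_separate])
      (auto simp: weight_functional_def)
  define \<alpha> where "\<alpha> i h = (if h \<in> H then \<phi> i (bracket h (y i)) else 0)" for i h
  have H: "cvec.subspace H" using cartan by (simp add: is_cartan_subalgebra_def is_lie_subalgebra_def)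
  have "\<alpha> i \<in> dual_space H" if "i < n" for i
  proof -
    have lin: "clinear (\<phi> i)" using \<phi>[OF that] by (simp add: weight_functional_def)
    show ?thesis
      using cvec.subspace_add[OF H] cvec.subspace_scale[OF H]
      by (simp add: dual_space_def \<alpha>_def bracket_add_left bracket_scale_left clinear_add[OF lin]
        clinear_scale[OF lin] cscale_complex_def)
  qed
  moreover have "bracket h (y i) = \<alpha> i h *\<^sub>C y i" if "i < n" "h \<in> H" for i h
  proof -
    have "\<phi> j (bracket h (y i)) = (if j = i then \<alpha> i h else 0)" if j: "j < n" for j
    proof -
      obtain c where "\<phi> j (bracket h (y i)) = c * \<phi> j (y i)"
        using \<phi>[OF j] \<open>h \<in> H\<close> by (auto simp: weight_functional_def)
      then show ?thesis using dual[OF j \<open>i < n\<close>] \<open>h \<in> H\<close> by (auto simp: \<alpha>_def)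
    qed
    then have "bracket h (y i) = (\<Sum>j<n. (if j = i then \<alpha> i h else 0) *\<^sub>C y j)"
      using expand[of "bracket h (y i)"] by simp
    also have "\<dots> = (\<Sum>j<n. if j = i then \<alpha> i h *\<^sub>C y i else 0)"
      by (rule sum.cong) auto
    finally show ?thesis using that by simp
  qed
  moreover have "x \<in> cvec.span (y ` {..<n})" for x
    by (subst expand) (intro cvec.span_sum cvec.span_scale cvec.span_base, blast)
  then have "cvec.span (y ` {..<n}) = UNIV" by blast
  ultimately show ?thesis using that by blast
qed

text \<open>An element centralizing \<open>H\<close> normalizes \<open>H\<close>.\<close>

lemma weight_zero_in_cartan:
  assumes "\<And>h. h \<in> H \<Longrightarrow> bracket h x = 0"
  shows "x \<in> H"
proof -
  have "bracket x h \<in> H" if "h \<in> H" for h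
  proof -
    have "bracket x h = 0" using assms[OF that] bracket_antisym[of x h] by simp
    then show ?thesis
      using cartan by (simp add: is_cartan_subalgebra_def is_lie_subalgebra_def cvec.subspace_0)
  qed
  then show ?thesis using cartan by (auto simp: is_cartan_subalgebra_def)
qed

lemma weight_vector_shifts:
  assumes x: "\<And>h. h \<in> H \<Longrightarrow> bracket h x = \<alpha> h *\<^sub>C x" and v: "v \<in> wt \<mu>"
  shows "act (x \<otimes> s) v \<in> wt (\<lambda>h. \<alpha> h + \<mu> h)"
  unfolding weight_space_def
proof (intro CollectI ballI)
  fix h assume h: "h \<in> H"
  have "act (bracket h x \<otimes> (1 * s)) v = act (h \<otimes> 1) (act (x \<otimes> s) v) - \<mu> h *\<^sub>C act (x \<otimes> s) v"
    using v h by (simp only: act_bracket_pure[OF module]) (simp add: weight_space_def act_scale)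
  then show "act (h \<otimes> 1) (act (x \<otimes> s) v) = (\<alpha> h + \<mu> h) *\<^sub>C act (x \<otimes> s) v"
    using x[OF h]
    by (simp add: pure_tensor_scale_left cvec.scale_left_distrib
      clinear_scale[OF clinear_act_left[OF module]] algebra_simps)
qed

lemma cartan_preserves_weight_spaces:
  assumes "h \<in> H" and "v \<in> wt \<mu>"
  shows "act (h \<otimes> s) v \<in> wt \<mu>"
  using weight_vector_shifts[of h "\<lambda>_. 0" v \<mu> s] assms by (simp add: cartan_abelian)

text \<open>Multiplication by \<open>r\<close> is realized by the bracket with \<open>k \<otimes> r\<close>:
  \<open>\<alpha> k (x \<otimes> r s) = [k \<otimes> r, x \<otimes> s]\<close>, and \<open>k \<otimes> r\<close> preserves the weight space of \<open>\<mu>\<close>. This is where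
  the root has to be nonzero.\<close>

lemma weight_vector_annihilator_ideal:
  assumes x: "\<And>h. h \<in> H \<Longrightarrow> bracket h x = \<alpha> h *\<^sub>C x" and k: "k \<in> H" "\<alpha> k \<noteq> 0"
  shows "is_alg_ideal {s. \<forall>v\<in>wt \<mu>. act (x \<otimes> s) v = 0}" (is "is_alg_ideal ?I")
  unfolding is_alg_ideal_def
proof (intro conjI allI ballI)
  show "cvec.subspace ?I"
    using clinear_act_pure_right[OF module, THEN clinear_add]
      clinear_act_pure_right[OF module, THEN clinear_scale]
      clinear_act_pure_right[OF module, THEN clinear_zero]
    by (simp add: cvec.subspace_def)
  fix r s assume s: "s \<in> ?I"
  have "act (x \<otimes> (r * s)) v = 0" if v: "v \<in> wt \<mu>" for v
  proof -
    have "act (bracket k x \<otimes> (r * s)) v = 0"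
      using s v cartan_preserves_weight_spaces[OF k(1) v]
      by (simp add: act_bracket_pure[OF module] act_zero)
    then show ?thesis
      using k by (simp add: x pure_tensor_scale_left clinear_scale[OF clinear_act_left[OF module]])
  qed
  then show "r * s \<in> ?I" by simp
qed

text \<open>The second claim writes the annihilator as an intersection of finitely many kernels: for \<open>k \<in> K\<close>
  and \<open>b\<close> in a finite spanning set of the weight space, \<open>s \<mapsto> (x\<^sub>k \<otimes> s) b\<close> is a linear map from \<open>S\<close> to
  the weight space of \<open>\<alpha>\<^sub>k + \<mu>\<close>.\<close>

lemma weight_vector_family_annihilator:
  fixes x :: "'k \<Rightarrow> 'g" and \<alpha> :: "'k \<Rightarrow> 'g \<Rightarrow> complex"
  assumes fin: "finite K"
    and x: "\<And>k h. k \<in> K \<Longrightarrow> h \<in> H \<Longrightarrow> bracket h (x k) = \<alpha> k h *\<^sub>C x k"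
    and \<alpha>: "\<And>k. k \<in> K \<Longrightarrow> \<alpha> k \<in> dual_space H"
    and nonzero: "\<And>k. k \<in> K \<Longrightarrow> \<exists>h\<in>H. \<alpha> k h \<noteq> 0"
    and \<mu>: "\<mu> \<in> dual_space H"
  shows "is_alg_ideal {s. \<forall>k\<in>K. \<forall>v\<in>wt \<mu>. act (x k \<otimes> s) v = 0}" (is "is_alg_ideal ?I")
    and "cofinite_in {s. \<forall>k\<in>K. \<forall>v\<in>wt \<mu>. act (x k \<otimes> s) v = 0}"
proof -
  have "is_alg_ideal {s. \<forall>v\<in>wt \<mu>. act (x k \<otimes> s) v = 0}" if "k \<in> K" for k
    using nonzero[OF that] weight_vector_annihilator_ideal[of "x k" "\<alpha> k"] x[OF that] by blast
  then show "is_alg_ideal ?I" by (force simp: is_alg_ideal_def cvec.subspace_def)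
  obtain B where B: "finite B" "cvec.span B = wt \<mu>"
    using weights \<mu> by (auto simp: has_fin_dim_weight_spaces_def fin_dim_def)
  have Bwt: "b \<in> wt \<mu>" if "b \<in> B" for b
    using that B(2) cvec.span_base by blast
  have "cofinite_in {s. \<forall>p\<in>K \<times> B. act (x (fst p) \<otimes> s) (snd p) = 0}"
  proof (rule cofinite_INT_kernels[where W = "\<lambda>p. wt (\<lambda>h. \<alpha> (fst p) h + \<mu> h)"])
    show "finite (K \<times> B)" using fin B by simp
    fix p assume p: "p \<in> K \<times> B"
    show "clinear (\<lambda>s. act (x (fst p) \<otimes> s) (snd p))" by (rule clinear_act_pure_right[OF module])
    have "(\<lambda>h. \<alpha> (fst p) h + \<mu> h) \<in> dual_space H"
      using \<alpha>[of "fst p"] p \<mu> by (auto simp: dual_space_def algebra_simps)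
    then show "fin_dim (wt (\<lambda>h. \<alpha> (fst p) h + \<mu> h))"
      using weights by (simp add: has_fin_dim_weight_spaces_def)
    show "act (x (fst p) \<otimes> s) (snd p) \<in> wt (\<lambda>h. \<alpha> (fst p) h + \<mu> h)" for s
      using p x Bwt by (intro weight_vector_shifts) auto
  qed
  moreover have "(\<forall>v\<in>wt \<mu>. act (x k \<otimes> s) v = 0) \<longleftrightarrow> (\<forall>b\<in>B. act (x k \<otimes> s) b = 0)" for k s
  proof
    assume "\<forall>b\<in>B. act (x k \<otimes> s) b = 0"
    then have "cvec.span B \<subseteq> {v. act (x k \<otimes> s) v = 0}"
      by (intro cvec.span_minimal subspace_clinear_kernel clinear_act[OF module]) auto
    then show "\<forall>v\<in>wt \<mu>. act (x k \<otimes> s) v = 0" using B(2) by blast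
  qed (use Bwt in blast)
  ultimately show "cofinite_in ?I" by simp
qed

text \<open>The ideal is the square of the common annihilator \<open>I\<close> of the weight space for the root vectors with
  nonzero root. Let \<open>R\<close> be the span of these root vectors. For \<open>r, r' \<in> R\<close> and \<open>s, t \<in> I\<close>, both
  \<open>r \<otimes> s t\<close> and \<open>[r, r'] \<otimes> s t = [r \<otimes> s, r' \<otimes> t]\<close> kill the weight space, and such elements span
  \<open>\<gg> \<otimes> I\<^sup>2\<close>.\<close>

lemma cofinite_annihilator_of_weight_space:
  assumes simple: "simple_lie_algebra TYPE('g)" and fg: "fin_gen_algebra TYPE('s)"
    and \<mu>: "\<mu> \<in> dual_space H"
  obtains I :: "'s set" where "is_alg_ideal I" and "cofinite_in I"
    and "\<And>x s v. s \<in> I \<Longrightarrow> v \<in> wt \<mu> \<Longrightarrow> act (x \<otimes> s) v = 0"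
proof -
  obtain n :: nat and y \<alpha> where \<alpha>: "\<And>i. i < n \<Longrightarrow> \<alpha> i \<in> dual_space H"
    and y: "\<And>i h. i < n \<Longrightarrow> h \<in> H \<Longrightarrow> bracket h (y i) = \<alpha> i h *\<^sub>C y i"
    and span: "cvec.span (y ` {..<n}) = UNIV"
    using exists_weight_basis by metis
  define K where "K = {i. i < n \<and> (\<exists>h\<in>H. \<alpha> i h \<noteq> 0)}"
  define R where "R = cvec.span (y ` K)"
  define I where "I = {s. \<forall>k\<in>K. \<forall>v\<in>wt \<mu>. act (y k \<otimes> s) v = 0}"
  have "finite K" by (simp add: K_def)
  then have I: "is_alg_ideal I" "cofinite_in I"
    unfolding I_def
    by (rule weight_vector_family_annihilator[of K y \<alpha> \<mu>]; use \<alpha> y \<mu> in \<open>auto simp: K_def\<close>)+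
  have subH: "cvec.subspace H"
    using cartan by (simp add: is_cartan_subalgebra_def is_lie_subalgebra_def)
  have HR: "bracket h r \<in> R" if h: "h \<in> H" and r: "r \<in> R" for h r
    using r unfolding R_def
  proof (rule span_closed_under_linear[OF clinear_bracket, rotated])
    fix x assume x: "x \<in> y ` K"
    then obtain c where "bracket h x = c *\<^sub>C x" using y h by (auto simp: K_def)
    then show "bracket h x \<in> cvec.span (y ` K)"
      using x by (simp add: cvec.span_scale cvec.span_base)
  qed
  have sum: "\<exists>h\<in>H. \<exists>r\<in>R. x = h + r" for x
  proof -
    have "y i \<in> H" if "i < n" "i \<notin> K" for i
      by (rule weight_zero_in_cartan) (use y that in \<open>auto simp: K_def\<close>)
    then have "y ` {..<n} \<subseteq> H \<union> y ` K" by blast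
    then have "x \<in> cvec.span (H \<union> y ` K)" using cvec.span_mono span by blast
    then show ?thesis
      unfolding cvec.span_Un R_def using subH by (auto simp: cvec.span_eq_iff[THEN iffD2])
  qed
  have generated: "cvec.span (R \<union> {bracket r r' | r r'. r \<in> R \<and> r' \<in> R}) = UNIV"
    by (rule simple_lie_algebra_generated[OF simple _ cartan_abelian HR sum])
      (simp_all add: R_def)
  have R0: "act (r \<otimes> s) v = 0" if "r \<in> R" "s \<in> I" "v \<in> wt \<mu>" for r s v
    by (rule act_subspace_zero[OF module, of "y ` K" "{s}"])
      (use that in \<open>auto simp: R_def I_def intro: cvec.span_base\<close>)
  have "act (x \<otimes> s) v = 0" if s: "s \<in> ideal_square I" and v: "v \<in> wt \<mu>" for x s v
  proof (rule act_subspace_zero[OF module])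
    show "x \<in> cvec.span (R \<union> {bracket r r' | r r'. r \<in> R \<and> r' \<in> R})" using generated by simp
    show "s \<in> cvec.span {s * t | s t. s \<in> I \<and> t \<in> I}" using s by (simp add: ideal_square_def)
    fix z q assume z: "z \<in> R \<union> {bracket r r' | r r'. r \<in> R \<and> r' \<in> R}"
      and "q \<in> {s * t | s t. s \<in> I \<and> t \<in> I}"
    then obtain s t where q: "q = s * t" "s \<in> I" "t \<in> I" by blast
    from z show "act (z \<otimes> q) v = 0"
    proof
      assume "z \<in> R"
      moreover have "q \<in> I" using q I by (simp add: is_alg_ideal_def)
      ultimately show ?thesis using v R0 by blast
    next
      assume "z \<in> {bracket r r' | r r'. r \<in> R \<and> r' \<in> R}"
      then obtain r r' where "z = bracket r r'" "r \<in> R" "r' \<in> R" by blast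
      then show ?thesis using q v by (simp add: act_bracket_pure[OF module] R0 act_zero)
    qed
  qed
  then show ?thesis
    using that ideal_square_ideal[OF I(1)] cofinite_ideal_square[OF fg I] by blast
qed

end


section \<open>Irreducible modules\<close>

text \<open>The kernel of \<open>\<gg> \<otimes> 1\<close> is a nonzero ideal, hence everything, and
  \<open>[x, y] \<otimes> s = [x \<otimes> 1, y \<otimes> s]\<close>, where the brackets \<open>[x, y]\<close> span \<open>\<gg>\<close>.\<close>

lemma trivial_action_if_not_faithful:
  fixes act :: "('g::complex_lie_algebra, 's::complex_comm_algebra) tensor \<Rightarrow> 'v::complex_vector_space \<Rightarrow> 'v"
  assumes simple: "simple_lie_algebra TYPE('g)" and module: "lie_module act"
    and kernel: "\<And>v. act (z \<otimes> 1) v = 0" "z \<noteq> 0"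
  shows "act (x \<otimes> s) v = 0"
proof -
  note lin = clinear_act_pure_left[OF module] and zero = clinear_zero[OF clinear_act[OF module]]
  let ?J = "{x. \<forall>v. act (x \<otimes> 1) v = 0}"
  have "act (bracket x y \<otimes> 1) v = 0" if "y \<in> ?J" for x y v
    using that act_bracket_pure[OF module, of x y 1 1 v] by (simp add: zero)
  then have "is_lie_ideal ?J"
    by (simp add: is_lie_ideal_def cvec.subspace_def lin[THEN clinear_add]
      lin[THEN clinear_scale] lin[THEN clinear_zero])
  then have J: "?J = UNIV"
    using kernel by (intro simple_ideal_UNIV[OF simple, of _ z]) auto
  have "act (bracket x y \<otimes> s) v = 0" for x y
  proof -
    have "act (x \<otimes> 1) w = 0" for w using J by blast
    then show ?thesis
      using act_bracket_pure[OF module, of x y 1 s v] by (simp add: zero)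
  qed
  then have "act (z \<otimes> r) v = 0" if "z \<in> {bracket x y | x y. True}" "r \<in> {s}" for z r
    using that by blast
  moreover have "x \<in> cvec.span {bracket x y | x y. True}"
    using simple_lie_algebra_perfect[OF simple] by simp
  moreover have "s \<in> cvec.span {s}" by (rule cvec.span_base) simp
  ultimately show ?thesis by (rule act_subspace_zero[OF module])
qed

lemma act_tensor_subspace_zero:
  assumes module: "lie_module act" and "\<And>x s. s \<in> I \<Longrightarrow> act (x \<otimes> s) v = 0"
    and "t \<in> tensor_subspace I"
  shows "act t v = 0"
proof -
  have "tensor_subspace I \<subseteq> {t. act t v = 0}"
    unfolding tensor_subspace_def
    using assms(2) by (intro cvec.span_minimal subspace_clinear_kernel clinear_act_left[OF module]) auto
  then show ?thesis using assms(3) by blast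
qed

theorem proposition6p6:
  fixes H :: "'g::complex_lie_algebra set"
    and act :: "('g, 's::complex_comm_algebra) tensor \<Rightarrow> 'v::complex_vector_space \<Rightarrow> 'v"
  assumes "fin_dim (UNIV :: 'g set)"
    and "simple_lie_algebra TYPE('g)"
    and "is_cartan_subalgebra H"
    and "fin_gen_algebra TYPE('s)"
    and "irreducible_module act"
    and "has_fin_dim_weight_spaces act H"
  shows "\<exists>I :: 's set. is_alg_ideal I \<and> cofinite_in I \<and>
           (\<forall>t\<in>tensor_subspace I. \<forall>v. act t v = 0)"
proof -
  have module: "lie_module act" using assms(5) by (simp add: irreducible_module_def)
  have "\<exists>I :: 's set. is_alg_ideal I \<and> cofinite_in I \<and> (\<forall>x. \<forall>s\<in>I. \<forall>v. act (x \<otimes> s) v = 0)"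
  proof (cases "\<exists>z. z \<noteq> 0 \<and> (\<forall>v. act (z \<otimes> 1) v = 0)")
    case True
    then have "act (x \<otimes> s) v = 0" for x s v
      using trivial_action_if_not_faithful[OF assms(2) module] by blast
    then show ?thesis
      using cofinite_UNIV by (intro exI[of _ UNIV]) (auto simp: is_alg_ideal_def)
  next
    case False
    interpret faithful_weight_module H act
      by unfold_locales (use assms module False in auto)
    obtain w :: 'v where "w \<noteq> 0" using assms(5) by (auto simp: irreducible_module_def)
    then have "\<exists>\<mu>. proj w \<mu> \<noteq> 0" using proj_sum[of w] by (auto intro: ccontr)
    then obtain \<mu> v where \<mu>: "\<mu> \<in> dual_space H" and v: "v \<in> wt \<mu>" "v \<noteq> 0"
      using proj_mem proj_outside by metis
    obtain I :: "'s set" where I: "is_alg_ideal I" "cofinite_in I"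
      and kill: "\<And>x s v. s \<in> I \<Longrightarrow> v \<in> wt \<mu> \<Longrightarrow> act (x \<otimes> s) v = 0"
      using cofinite_annihilator_of_weight_space[OF assms(2,4) \<mu>] by blast
    have "v \<in> {v. \<forall>x. \<forall>s\<in>I. act (x \<otimes> s) v = 0}" using kill v by blast
    then have "{v. \<forall>x. \<forall>s\<in>I. act (x \<otimes> s) v = 0} = UNIV"
      using annihilated_submodule[OF module I(1)] assms(5) v(2)
      unfolding irreducible_module_def by blast
    then show ?thesis using I by blast
  qed
  then show ?thesis using act_tensor_subspace_zero[OF module] by blast
qed

end
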